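(* Let $H^2_{\beta}$ be the weighted Hardy space induced by a weight sequence $w=\{w_k\}_{k=1}^{\infty}$ with $w_k\to 1$. Suppose that there exist a sequence of positive numbers $\{\alpha_j\}_{j=1}^{\infty}$ tending to infinity and a sequence of positive integers $\{n_j\}_{j=1}^{\infty}$ tending to infinity such that, for every $j$ and every $0\le k\le n_j$, $$\frac{\beta_{n_j}}{\beta_k}\ \ge\ \frac{\beta_k^{(\alpha_j)}}{\beta_{n_j}^{(\alpha_j)}}.$$ Then, for any $t\in(0,1)$, $$\frac{\|\varphi_t^{n_j}\|^2_{\beta^{-1}}}{\|z^{n_j}\|^2_{\beta^{-1}}}\to\infty\quad\text{as } j\to\infty .$$ Consequently, the composition operators $C_{\varphi_t}:H^2_{\beta^{-1}}\to H^2_{\beta^{-1}}$ and $C_{\varphi_t}:H^2_{\beta}\to H^2_{\beta}$ are unbounded. In particular, if $\lim_{k\to\infty}(k+1)(w_k-1)=+\infty$ or $\lim_{k\to\infty}(k+1)(w_k-1)=-\infty$, then for any $t\in(0,1)$ the operators $C_{\varphi_t}$ on $H^2_{\beta^{-1}}$ and $C_{\varphi_t}$ on $H^2_\beta$ are unbounded.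
   Context: $\mathbb{D}$ is the open unit disk in $\mathbb{C}$. For a sequence $w=\{w_k\}_{k\ge1}$ of positive numbers, put $\beta_0=1$, $\beta_k=\prod_{j=1}^k w_j$. The weighted Hardy space $H^2_\beta$ induced by $w$ (with $w_k\to1$) is the Hilbert space of functions $f(z)=\sum_{k\ge0}\widehat f(k)z^k$ analytic on $\mathbb{D}$ with $\|f\|_\beta^2=\sum_{k\ge0}|\widehat f(k)|^2\beta_k^2<\infty$. $\beta^{-1}=\{1/\beta_k\}_{k\ge0}$, so $H^2_{\beta^{-1}}$ is the weighted Hardy space induced by $\{1/w_k\}$, with norm $\|f\|_{\beta^{-1}}^2=\sum_{k\ge0}|\widehat f(k)|^2\beta_k^{-2}$. For $\alpha\ge0$, $\beta_0^{(\alpha)}=1$ and $\beta_k^{(\alpha)}=\prod_{j=1}^k\sqrt{\frac{j+1}{j+2\alpha+1}}$ for $k\ge1$. For $t\in(0,1)$, $\varphi_t(z)=\frac{t-z}{1-tz}$, $\varphi_t^{n}$ is its $n$-th power, and $C_{\varphi_t}f=f\circ\varphi_t$. "Unbounded on $H^2_\gamma$" means that $C_{\varphi_t}$ does not define a bounded operator from $H^2_\gamma$ to itself. *)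

theory Defs
  imports "HOL-Complex_Analysis.Complex_Analysis"
begin

text \<open>
  A weight sequence is indexed from 1; the value \<open>w 0\<close> is never used.
\<close>

definition weight_prod :: "(nat \<Rightarrow> real) \<Rightarrow> nat \<Rightarrow> real" where
  "weight_prod w k = (\<Prod>j=1..k. w j)"

definition beta_alpha :: "real \<Rightarrow> nat \<Rightarrow> real" where
  "beta_alpha \<alpha> = weight_prod (\<lambda>j. sqrt ((real j + 1) / (real j + 2 * \<alpha> + 1)))"

definition taylor_coeff :: "(complex \<Rightarrow> complex) \<Rightarrow> nat \<Rightarrow> complex" where
  "taylor_coeff f k = (deriv ^^ k) f 0 / fact k"

text \<open>
  An analytic function on the open unit disk is represented by a total function that is holomorphic
  on \<open>ball 0 1\<close>; its values elsewhere are irrelevant, as they do not affect the Taylor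
  coefficients at 0.  The parameter \<open>\<gamma>\<close> is the sequence \<open>\<beta>\<close> of partial products, not the
  weight sequence \<open>w\<close> itself.
\<close>

definition weighted_hardy :: "(nat \<Rightarrow> real) \<Rightarrow> (complex \<Rightarrow> complex) set" where
  "weighted_hardy \<gamma> =
     {f. f holomorphic_on ball 0 1 \<and> summable (\<lambda>k. (cmod (taylor_coeff f k))\<^sup>2 * (\<gamma> k)\<^sup>2)}"

text \<open>Meaningful only for elements of \<open>weighted_hardy \<gamma>\<close>.\<close>

definition hardy_norm :: "(nat \<Rightarrow> real) \<Rightarrow> (complex \<Rightarrow> complex) \<Rightarrow> real" where
  "hardy_norm \<gamma> f = sqrt (\<Sum>k. (cmod (taylor_coeff f k))\<^sup>2 * (\<gamma> k)\<^sup>2)"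

definition disk_aut :: "real \<Rightarrow> complex \<Rightarrow> complex" where
  "disk_aut t z = (of_real t - z) / (1 - of_real t * z)"

text \<open>
  Linearity of \<open>f \<mapsto> f \<circ> \<phi>\<close> is automatic, so being a bounded operator
  amounts to mapping the space into itself with a norm estimate.
\<close>

definition bounded_composition_op :: "(nat \<Rightarrow> real) \<Rightarrow> (complex \<Rightarrow> complex) \<Rightarrow> bool" where
  "bounded_composition_op \<gamma> \<phi> \<longleftrightarrow>
     (\<forall>f \<in> weighted_hardy \<gamma>. f \<circ> \<phi> \<in> weighted_hardy \<gamma>) \<and>
     (\<exists>C. \<forall>f \<in> weighted_hardy \<gamma>. hardy_norm \<gamma> (f \<circ> \<phi>) \<le> C * hardy_norm \<gamma> f)"

end

theory Submission
  imports Defs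
begin

text \<open>
  Let \<open>c\<^sub>k\<close> be the Taylor coefficients of \<open>\<phi>\<^sup>n\<close> for the disk automorphism \<open>\<phi>\<close>.  Since
  \<open>\<bar>\<phi>\<bar> = 1\<close> on the unit circle, Parseval's formula there gives \<open>\<Sum> \<bar>c\<^sub>k\<bar>\<^sup>2 = 1\<close>,
  \<open>\<Sum> k \<bar>c\<^sub>k\<bar>\<^sup>2 = n\<close> and \<open>\<Sum> (k - n) c\<^sub>k cnj c\<^sub>k\<^sub>-\<^sub>1 = n t\<close>.  So \<open>k / n\<close> has mean \<open>1\<close> under
  the probability weights \<open>\<bar>c\<^sub>k\<bar>\<^sup>2\<close>, and by the third identity and AM-GM its mean absolute
  deviation is bounded below; hence \<open>\<Sum>\<^sub>k\<^sub>\<le>\<^sub>n (1 - k / n) \<bar>c\<^sub>k\<bar>\<^sup>2\<close> is bounded below by about \<open>t / 2\<close>.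
  By Bernoulli's inequality the squared ratio of the weights \<open>\<beta>\<^sup>(\<^sup>\<alpha>\<^sup>)\<close> at \<open>k\<close> and \<open>n\<close> is at
  least a multiple of \<open>\<alpha> (1 - k / n)\<close>, and the norm quotient tends to infinity with \<open>\<alpha>\<close>.

  For the dual space, boundedness of \<open>C\<^sub>\<phi>\<close> on \<open>H\<^sup>2\<^sub>\<beta>\<close> bounds the columns of its matrix
  \<open>(c\<^sub>n\<^sub>k)\<close> in the inverse weights, and the symmetry \<open>k c\<^sub>n\<^sub>k = n c\<^sub>k\<^sub>n\<close> turns columns into rows.
\<close>

section \<open>Taylor coefficients at 0 and their decay\<close>

lemma taylor_coeff_eq_fps_nth:
  "f has_fps_expansion F \<Longrightarrow> taylor_coeff f k = fps_nth F k"
  by (simp add: taylor_coeff_def fps_nth_fps_expansion)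

lemma has_fps_expansion_taylor:
  assumes "f holomorphic_on ball 0 r" "r > 0"
  shows "f has_fps_expansion Abs_fps (taylor_coeff f)"
proof -
  have "f has_fps_expansion fps_expansion f 0"
    by (rule has_fps_expansion_fps_expansion[of "ball 0 r"]) (use assms in auto)
  then show ?thesis
    by (simp add: fps_expansion_def taylor_coeff_def [abs_def])
qed

lemma taylor_coeff_times_id:
  assumes "f holomorphic_on ball 0 r" "r > 0"
  shows "taylor_coeff (\<lambda>z. z * f z) k = (if k = 0 then 0 else taylor_coeff f (k - 1))"
proof -
  have "(\<lambda>z. z * f z) has_fps_expansion fps_X * Abs_fps (taylor_coeff f)"
    by (intro fps_expansion_intros has_fps_expansion_taylor[OF assms])
  then show ?thesis
    by (simp add: taylor_coeff_eq_fps_nth)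
qed

lemma taylor_coeff_euler:
  assumes "f holomorphic_on ball 0 r" "r > 0"
  shows "taylor_coeff (\<lambda>z. z * deriv f z) k = of_nat k * taylor_coeff f k"
proof -
  have "(\<lambda>z. z * deriv f z) has_fps_expansion fps_X * fps_deriv (Abs_fps (taylor_coeff f))"
    by (intro fps_expansion_intros has_fps_expansion_taylor[OF assms])
  then show ?thesis
    by (cases k) (simp_all add: taylor_coeff_eq_fps_nth)
qed

lemma taylor_coeff_monomial: "taylor_coeff (\<lambda>z. z ^ n) k = (if k = n then 1 else 0)"
proof -
  have "(\<lambda>z::complex. z ^ n) has_fps_expansion fps_X ^ n"
    by (intro fps_expansion_intros)
  then show ?thesis
    by (simp add: taylor_coeff_eq_fps_nth fps_X_power_nth)
qed

lemma taylor_coeff_sum: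
  assumes "\<And>i. i \<in> A \<Longrightarrow> f i holomorphic_on ball 0 r" "r > 0"
  shows "taylor_coeff (\<lambda>z. \<Sum>i\<in>A. x i * f i z) k = (\<Sum>i\<in>A. x i * taylor_coeff (f i) k)"
proof -
  have "(\<lambda>z. \<Sum>i\<in>A. x i * f i z) has_fps_expansion
          (\<Sum>i\<in>A. fps_const (x i) * Abs_fps (taylor_coeff (f i)))"
    by (intro fps_expansion_intros has_fps_expansion_taylor[OF assms])
  then show ?thesis
    by (simp add: taylor_coeff_eq_fps_nth fps_sum_nth)
qed

lemma taylor_coeff_sums:
  assumes "f holomorphic_on ball 0 r" "cmod z < r"
  shows "(\<lambda>k. taylor_coeff f k * z ^ k) sums f z"
  using holomorphic_power_series[OF assms(1), of z] assms(2)
  by (simp add: taylor_coeff_def)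

text \<open>The power series converges at the point \<open>s\<close>, so its terms there are
  bounded.\<close>

lemma taylor_coeff_bound:
  assumes "f holomorphic_on ball 0 r" "0 < s" "s < r"
  obtains C where "C > 0" "\<And>k. cmod (taylor_coeff f k) \<le> C * (1 / s) ^ k"
proof -
  have "summable (\<lambda>k. taylor_coeff f k * of_real s ^ k)"
    by (rule sums_summable[OF taylor_coeff_sums[OF assms(1)]]) (use assms in auto)
  then have "Bseq (\<lambda>k. taylor_coeff f k * of_real s ^ k)"
    by (rule summable_imp_Bseq)
  then obtain C where C: "C > 0" "\<And>k. norm (taylor_coeff f k * of_real s ^ k) \<le> C"
    by (auto simp: Bseq_def)
  have "cmod (taylor_coeff f k) \<le> C * (1 / s) ^ k" for k
    using C(2)[of k] assms(2)
    by (simp add: norm_mult norm_power field_simps)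
  with C(1) show ?thesis
    using that by blast
qed

lemma summable_norm_taylor_coeff:
  assumes "f holomorphic_on ball 0 r" "r > 1"
  shows "summable (\<lambda>k. cmod (taylor_coeff f k))"
proof -
  obtain s where s: "1 < s" "s < r"
    using dense[OF assms(2)] by blast
  then have "0 < s"
    by simp
  then obtain C where C: "\<And>k. cmod (taylor_coeff f k) \<le> C * (1 / s) ^ k"
    using taylor_coeff_bound[OF assms(1) _ s(2)] by metis
  have "summable (\<lambda>k. C * (1 / s) ^ k)"
    using s by (intro summable_mult summable_geometric) simp
  then show ?thesis
    by (rule summable_comparison_test'[where N = 0]) (simp add: C)
qed

section \<open>Parseval's formula on the unit circle\<close>

lemma cnj_eq_inverse_on_circle: "cmod z = 1 \<Longrightarrow> cnj z = 1 / z"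
  by (metis complex_div_cnj complex_norm_square div_by_1 mult_1 of_real_1 one_power2 power_one)

text \<open>On the circle \<open>cnj (g z)\<close> is the sum of
  \<open>cnj (taylor_coeff g k) / z ^ k\<close>, and Cauchy's formula extracts the coefficient
  \<open>k\<close> of \<open>f\<close> from each term. The radius beyond 1 makes the coefficients of
  \<open>g\<close> absolutely summable, so the limit passes through the integral. As
  \<open>h\<close> has to agree with the integrand on the circle only, a rational function with a
  known integral can take its place.\<close>

lemma parseval_circle:
  assumes f: "f holomorphic_on ball 0 r" and g: "g holomorphic_on ball 0 r" and r: "r > 1"
    and h: "\<And>z. cmod z = 1 \<Longrightarrow> h z = f z * cnj (g z) / z"
    and I: "(h has_contour_integral 2 * of_real pi * \<i> * I) (circlepath 0 1)"
  shows "(\<lambda>k. taylor_coeff f k * cnj (taylor_coeff g k)) sums I"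
proof -
  \<comment> \<open>\<open>G n\<close> is a partial sum of \<open>f z * cnj (g z) / z\<close> with
    \<open>cnj z\<close> replaced by \<open>1 / z\<close>; the form \<open>z - 0\<close> is that of
    Cauchy's formula for derivatives.\<close>
  define G where "G n z = (\<Sum>k<n. cnj (taylor_coeff g k) * (f z / (z - 0) ^ Suc k))" for n z
  have contf: "continuous_on (cball 0 1) f"
    by (rule continuous_on_subset[OF holomorphic_on_imp_continuous_on[OF f]]) (use r in auto)
  have holf: "f holomorphic_on ball 0 1"
    by (rule holomorphic_on_subset[OF f]) (use r in auto)
  have int: "(G n has_contour_integral
      (\<Sum>k<n. cnj (taylor_coeff g k) * (2 * pi * \<i> / fact k * (deriv ^^ k) f 0))) (circlepath 0 1)" for n
    unfolding G_def
    by (intro has_contour_integral_sum has_contour_integral_lmul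
          Cauchy_has_contour_integral_higher_derivative_circlepath contf holf) auto
  have "bounded (f ` sphere 0 1)"
    by (intro compact_imp_bounded compact_continuous_image continuous_on_subset[OF contf]) auto
  then obtain B where B: "\<And>z. cmod z = 1 \<Longrightarrow> cmod (f z) \<le> B"
    unfolding bounded_iff by (metis image_eqI mem_sphere_0)
  have "uniform_limit (sphere 0 1)
      (\<lambda>n z. \<Sum>k<n. cnj (taylor_coeff g k) * (f z / (z - 0) ^ Suc k))
      (\<lambda>z. \<Sum>k. cnj (taylor_coeff g k) * (f z / (z - 0) ^ Suc k)) sequentially"
  proof (rule Weierstrass_m_test)
    fix k and z :: complex assume z: "z \<in> sphere 0 1"
    have "cmod (f z) * cmod (taylor_coeff g k) \<le> B * cmod (taylor_coeff g k)"
      by (intro mult_right_mono B) (use z in auto)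
    then show "norm (cnj (taylor_coeff g k) * (f z / (z - 0) ^ Suc k)) \<le> B * cmod (taylor_coeff g k)"
      using z by (simp add: norm_mult norm_divide norm_power mult.commute)
  next
    show "summable (\<lambda>k. B * cmod (taylor_coeff g k))"
      by (intro summable_mult summable_norm_taylor_coeff[OF g r])
  qed
  also have "?this \<longleftrightarrow> uniform_limit (sphere 0 1) G h sequentially"
  proof (rule uniform_limit_cong')
    fix z :: complex assume "z \<in> sphere 0 1"
    then have z: "cmod z = 1" by simp
    then have z0: "z \<noteq> 0" by auto
    have "(\<lambda>k. cnj (taylor_coeff g k * z ^ k)) sums cnj (g z)"
      using taylor_coeff_sums[OF g, of z] z r by (simp only: sums_cnj)
    then have "(\<lambda>k. f z / z * cnj (taylor_coeff g k * z ^ k)) sums (f z / z * cnj (g z))"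
      by (rule sums_mult)
    moreover have "f z / z * cnj (taylor_coeff g k * z ^ k) = cnj (taylor_coeff g k) * (f z / (z - 0) ^ Suc k)" for k
      using z0 by (simp add: cnj_eq_inverse_on_circle[OF z] power_divide field_simps)
    ultimately have "(\<lambda>k. cnj (taylor_coeff g k) * (f z / (z - 0) ^ Suc k)) sums (f z / z * cnj (g z))"
      by simp
    then show "(\<Sum>k. cnj (taylor_coeff g k) * (f z / (z - 0) ^ Suc k)) = h z"
      by (simp add: sums_iff h[OF z])
  qed (simp add: G_def)
  finally have lim: "uniform_limit (path_image (circlepath 0 1)) G h sequentially"
    by simp
  have "(\<lambda>n. contour_integral (circlepath 0 1) (G n)) \<longlonglongrightarrow> contour_integral (circlepath 0 1) h"
    by (rule contour_integral_uniform_limit_circlepath)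
       (use lim int in \<open>auto intro!: always_eventually has_contour_integral_integrable simp del: sum.lessThan_Suc\<close>)
  then have "(\<lambda>n. \<Sum>k<n. cnj (taylor_coeff g k) * (2 * pi * \<i> / fact k * (deriv ^^ k) f 0))
      \<longlonglongrightarrow> 2 * of_real pi * \<i> * I"
    by (simp add: contour_integral_unique[OF int] contour_integral_unique[OF I])
  then have "(\<lambda>k. cnj (taylor_coeff g k) * (2 * pi * \<i> / fact k * (deriv ^^ k) f 0))
      sums (2 * of_real pi * \<i> * I)"
    by (simp add: sums_def)
  then have "(\<lambda>k. 2 * of_real pi * \<i> * (taylor_coeff f k * cnj (taylor_coeff g k)))
      sums (2 * of_real pi * \<i> * I)"
    by (simp add: taylor_coeff_def mult_ac)
  from sums_divide[OF this, of "2 * of_real pi * \<i>"] show ?thesis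
    by simp
qed

section \<open>The disk automorphism and residues on the unit circle\<close>

lemma disk_aut_denom_nonzero:
  assumes "0 < t" "cmod z < 1 / t"
  shows "1 - of_real t * z \<noteq> 0"
proof
  assume "1 - of_real t * z = 0"
  then have "cmod (of_real t * z) = 1"
    by (metis eq_iff_diff_eq_0 norm_one)
  then show False
    using assms by (simp add: norm_mult field_simps)
qed

lemma disk_aut_power_holomorphic:
  assumes "0 < t"
  shows "(\<lambda>z. disk_aut t z ^ n) holomorphic_on ball 0 (1 / t)"
  unfolding disk_aut_def using disk_aut_denom_nonzero[OF assms]
  by (intro holomorphic_intros) auto

lemma norm_disk_aut_circle:
  assumes "0 < t" "t < 1" "cmod z = 1"
  shows "cmod (disk_aut t z) = 1"
proof -
  have z: "z * cnj z = 1"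
    using assms(3) by (simp add: complex_norm_square [symmetric])
  have ne: "1 - of_real t * z \<noteq> 0"
    using disk_aut_denom_nonzero[of t z] assms by simp
  have "of_real t - z = - z * cnj (1 - of_real t * z)"
    using z by (simp add: algebra_simps)
  then have "cmod (of_real t - z) = cmod (1 - of_real t * z)"
    by (simp only: norm_mult norm_minus_cancel complex_mod_cnj assms(3) mult_1)
  then show ?thesis
    using ne by (simp add: disk_aut_def norm_divide)
qed

text \<open>The logarithmic derivative z \<phi>' / \<phi> splits into partial fractions with poles
  at \<open>1 / t\<close> and \<open>t\<close>. On the unit circle \<phi>^n cancels against its
  conjugate, and only rational functions remain to be integrated.\<close>

lemma disk_aut_power_euler:
  assumes t: "0 < t" "t < 1" and z: "cmod z < 1 / t" "z \<noteq> of_real t"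
  shows "z * deriv (\<lambda>z. disk_aut t z ^ n) z =
    of_nat n * (1 / (1 - of_real t * z) + of_real t / (z - of_real t)) * disk_aut t z ^ n"
proof -
  have ne: "1 - of_real t * z \<noteq> 0"
    using disk_aut_denom_nonzero[of t z] assms by simp
  have zt: "z - of_real t \<noteq> 0" "of_real t - z \<noteq> 0"
    using z by auto
  have der: "(disk_aut t has_field_derivative
      (-1 * (1 - of_real t * z) - (of_real t - z) * (- of_real t)) /
        ((1 - of_real t * z) * (1 - of_real t * z))) (at z)"
    unfolding disk_aut_def [abs_def] using ne
    by (auto intro!: derivative_eq_intros)
  have pow: "disk_aut t z ^ n = disk_aut t z ^ (n - 1) * ((of_real t - z) / (1 - of_real t * z))"
    if "n > 0"
    using that by (cases n) (simp_all add: disk_aut_def)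
  define D where "D = (-1 * (1 - of_real t * z) - (of_real t - z) * (- of_real t)) /
        ((1 - of_real t * z) * (1 - of_real t * z))"
  have D: "z * D = (1 / (1 - of_real t * z) + of_real t / (z - of_real t)) *
      ((of_real t - z) / (1 - of_real t * z))"
    unfolding D_def using ne zt by (simp add: divide_simps) (simp add: algebra_simps power2_eq_square)
  have "z * deriv (\<lambda>z. disk_aut t z ^ n) z = of_nat n * (z * D) * disk_aut t z ^ (n - 1)"
    using DERIV_imp_deriv[OF DERIV_power[OF der, of n]] by (simp add: D_def)
  also have "\<dots> = of_nat n * (1 / (1 - of_real t * z) + of_real t / (z - of_real t)) * disk_aut t z ^ n"
    unfolding D using pow by (cases "n = 0") simp_all
  finally show ?thesis .
qed

text \<open>The poles at 0 and \<open>t\<close> lie inside the circle, \<open>1 / t\<close> lies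
  outside, and \<open>d / z ^ 2\<close> has residue 0. The four moments below all integrate an
  instance of this template.\<close>

lemma circle_integral_partial_fractions:
  assumes "0 < t" "t < 1"
  shows "((\<lambda>z. a / (1 - of_real t * z) + b / z + c / (z - of_real t) + d / z ^ 2)
     has_contour_integral 2 * of_real pi * \<i> * (b + c)) (circlepath 0 1)"
proof -
  have 1: "((\<lambda>z. a / (1 - of_real t * z)) has_contour_integral 0) (circlepath 0 1)"
    by (rule Cauchy_theorem_disc_simple[of _ 0 "1 / t"])
       (use assms disk_aut_denom_nonzero[of t] in \<open>auto intro!: holomorphic_intros simp: field_simps\<close>)
  have 2: "((\<lambda>z. b / (z - 0)) has_contour_integral 2 * of_real pi * \<i> * b) (circlepath 0 1)"
    by (rule Cauchy_integral_circlepath_simple) auto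
  have 3: "((\<lambda>z. c / (z - of_real t)) has_contour_integral 2 * of_real pi * \<i> * c) (circlepath 0 1)"
    by (rule Cauchy_integral_circlepath_simple) (use assms in auto)
  have 4: "((\<lambda>z. d / (z - 0) ^ Suc 1) has_contour_integral
      (2 * pi * \<i>) / fact 1 * (deriv ^^ 1) (\<lambda>z. d) 0) (circlepath 0 1)"
    by (rule Cauchy_has_contour_integral_higher_derivative_circlepath) auto
  have "(2 * pi * \<i>) / fact 1 * (deriv ^^ 1) (\<lambda>z. d) 0 = 0"
    by simp
  with 4 have 4: "((\<lambda>z. d / z ^ 2) has_contour_integral 0) (circlepath 0 1)"
    by (simp add: power2_eq_square)
  show ?thesis
    using has_contour_integral_add[OF has_contour_integral_add[OF has_contour_integral_add[OF 1 2] 3] 4]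
    by (simp add: distrib_left)
qed

section \<open>Moments of the Taylor coefficients of a power of the automorphism\<close>

lemma sums_Suc_of_zero:
  fixes f :: "nat \<Rightarrow> 'a::real_normed_vector"
  shows "f sums s \<Longrightarrow> f 0 = 0 \<Longrightarrow> (\<lambda>k. f (Suc k)) sums s"
  by (simp add: sums_Suc_iff)

context
  fixes t :: real and n :: nat and c :: "nat \<Rightarrow> complex"
  assumes t: "0 < t" "t < 1"
  defines "c \<equiv> taylor_coeff (\<lambda>z. disk_aut t z ^ n)"
begin

lemma disk_aut_power_hol: "(\<lambda>z. disk_aut t z ^ n) holomorphic_on ball 0 (1 / t)" and disk_aut_radius: "1 / t > 1" "1 / t > 0"
  using t disk_aut_power_holomorphic by auto

lemma disk_aut_id_power_hol: "(\<lambda>z. z * disk_aut t z ^ n) holomorphic_on ball 0 (1 / t)"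
  and disk_aut_euler_power_hol: "(\<lambda>z. z * deriv (\<lambda>z. disk_aut t z ^ n) z) holomorphic_on ball 0 (1 / t)"
  by (intro holomorphic_intros disk_aut_power_hol open_ball)+

lemma disk_aut_power_unimodular: "cmod z = 1 \<Longrightarrow> disk_aut t z ^ n * cnj (disk_aut t z ^ n) = 1"
  using norm_disk_aut_circle[OF t, of z]
  by (simp add: complex_norm_square [symmetric] flip: power_mult_distrib)

lemma circle_partial_fraction:
  assumes "cmod z = 1"
  shows "1 / (z * (1 - of_real t * z)) = of_real t / (1 - of_real t * z) + 1 / z"
    and "of_real t / (z * (z - of_real t)) = 1 / (z - of_real t) - 1 / z"
    and "z \<noteq> 0" "z - of_real t \<noteq> 0" "1 - of_real t * z \<noteq> 0"
proof -
  show ne: "z \<noteq> 0" "z - of_real t \<noteq> 0" "1 - of_real t * z \<noteq> 0"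
    using assms t disk_aut_denom_nonzero[of t z] by auto
  show "1 / (z * (1 - of_real t * z)) = of_real t / (1 - of_real t * z) + 1 / z"
    "of_real t / (z * (z - of_real t)) = 1 / (z - of_real t) - 1 / z"
    using ne by (simp_all add: field_simps)
qed

text \<open>Parseval for \<phi>^n against itself: on the circle the integrand is
  \<open>1 / z\<close>.\<close>

lemma disk_aut_power_norm_sums: "(\<lambda>k. (cmod (c k))\<^sup>2) sums 1"
proof -
  have "(\<lambda>k. c k * cnj (c k)) sums 1"
    unfolding c_def
  proof (rule parseval_circle[OF disk_aut_power_hol disk_aut_power_hol disk_aut_radius(1)])
    fix z assume "cmod z = 1"
    \<comment> \<open>The zero terms bring the integrand \<open>1 / z\<close> into the form of the
      partial fraction template.\<close>
    then show "0 / (1 - of_real t * z) + 1 / z + 0 / (z - of_real t) + 0 / z ^ 2 =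
      disk_aut t z ^ n * cnj (disk_aut t z ^ n) / z"
      by (simp only: disk_aut_power_unimodular) simp
  qed (use circle_integral_partial_fractions[OF t, of 0 1 0 0] in simp)
  then have "(\<lambda>k. complex_of_real ((cmod (c k))\<^sup>2)) sums of_real 1"
    by (simp only: complex_norm_square of_real_1)
  then show ?thesis
    by (simp only: sums_of_real_iff)
qed

text \<open>Parseval for \<phi>^n against z \<phi>^n: the integrand \<open>1 / z ^ 2\<close> has no
  residue. Multiplication by z shifts the coefficients by one, and the term at index 0
  vanishes.\<close>

lemma disk_aut_power_shift_sums: "(\<lambda>k. c (Suc k) * cnj (c k)) sums 0"
proof -
  have "(\<lambda>k. taylor_coeff (\<lambda>z. disk_aut t z ^ n) k *
      cnj (taylor_coeff (\<lambda>z. z * disk_aut t z ^ n) k)) sums 0"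
  proof (rule parseval_circle[OF disk_aut_power_hol disk_aut_id_power_hol disk_aut_radius(1)])
    fix z assume z: "cmod z = 1"
    have "disk_aut t z ^ n * cnj (z * disk_aut t z ^ n) / z
        = disk_aut t z ^ n * cnj (disk_aut t z ^ n) * cnj z / z"
      by simp
    then show "0 / (1 - of_real t * z) + 0 / z + 0 / (z - of_real t) + 1 / z ^ 2 =
      disk_aut t z ^ n * cnj (z * disk_aut t z ^ n) / z"
      by (simp only: disk_aut_power_unimodular[OF z] cnj_eq_inverse_on_circle[OF z]) (simp add: power2_eq_square)
  qed (use circle_integral_partial_fractions[OF t, of 0 0 0 1] in simp)
  from sums_Suc_of_zero[OF this[unfolded taylor_coeff_times_id[OF disk_aut_power_hol disk_aut_radius(2)]]]
  show ?thesis
    by (simp add: c_def)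
qed

text \<open>Parseval for z (\<phi>^n)' against \<phi>^n: the \<open>1 / z\<close> terms of the two
  partial fractions cancel, and the pole at \<open>t\<close> contributes \<open>n\<close>.\<close>

lemma disk_aut_power_mean_sums: "(\<lambda>k. real k * (cmod (c k))\<^sup>2) sums real n"
proof -
  have "(\<lambda>k. taylor_coeff (\<lambda>z. z * deriv (\<lambda>z. disk_aut t z ^ n) z) k *
      cnj (taylor_coeff (\<lambda>z. disk_aut t z ^ n) k)) sums of_nat n"
  proof (rule parseval_circle[OF disk_aut_euler_power_hol disk_aut_power_hol disk_aut_radius(1)])
    fix z assume z: "cmod z = 1"
    note pf = circle_partial_fraction[OF z]
    have "z * deriv (\<lambda>z. disk_aut t z ^ n) z * cnj (disk_aut t z ^ n) / z
        = of_nat n * (1 / (1 - of_real t * z) + of_real t / (z - of_real t)) *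
          (disk_aut t z ^ n * cnj (disk_aut t z ^ n)) / z"
      by (subst disk_aut_power_euler[OF t]) (use z disk_aut_radius pf in auto)
    also have "\<dots> = of_nat n * (1 / (z * (1 - of_real t * z)) + of_real t / (z * (z - of_real t)))"
      unfolding disk_aut_power_unimodular[OF z] using pf(3-5) by (simp add: divide_simps)
    also have "\<dots> = of_nat n * of_real t / (1 - of_real t * z) + 0 / z + of_nat n / (z - of_real t) + 0 / z ^ 2"
      unfolding pf(1,2) by (simp add: algebra_simps)
    finally show "of_nat n * of_real t / (1 - of_real t * z) + 0 / z + of_nat n / (z - of_real t) + 0 / z ^ 2 =
      z * deriv (\<lambda>z. disk_aut t z ^ n) z * cnj (disk_aut t z ^ n) / z" ..
  qed (use circle_integral_partial_fractions[OF t, of "of_nat n * of_real t" 0 "of_nat n" 0] in simp)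
  then have "(\<lambda>k. complex_of_real (real k * (cmod (c k))\<^sup>2)) sums of_real (real n)"
    unfolding taylor_coeff_euler[OF disk_aut_power_hol disk_aut_radius(2)] c_def [symmetric]
    by (simp only: of_real_mult complex_norm_square of_real_of_nat_eq mult.assoc)
  then show ?thesis
    by (simp only: sums_of_real_iff)
qed

text \<open>Parseval for z (\<phi>^n)' against z \<phi>^n: the residues at 0 and \<open>t\<close>
  are n (t - 1/t) and n / t.\<close>

lemma disk_aut_power_shift_mean_sums:
  "(\<lambda>k. of_nat (Suc k) * c (Suc k) * cnj (c k)) sums of_real (real n * t)"
proof -
  have "(\<lambda>k. taylor_coeff (\<lambda>z. z * deriv (\<lambda>z. disk_aut t z ^ n) z) k *
      cnj (taylor_coeff (\<lambda>z. z * disk_aut t z ^ n) k)) sums of_real (real n * t)"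
  proof (rule parseval_circle[OF disk_aut_euler_power_hol disk_aut_id_power_hol disk_aut_radius(1)])
    fix z assume z: "cmod z = 1"
    note pf = circle_partial_fraction[OF z]
    \<comment> \<open>With the denominators abstracted, the two inner \<open>1 / z\<close> terms
      cancel; the outer division by \<open>z\<close> stays and calls for a second partial fraction
      expansion.\<close>
    have collect: "of_nat n * (of_real t / p + 1 / z + (1 / q - 1 / z)) / z =
        of_nat n * (of_real t / (z * p) + 1 / (z * q))" if "z \<noteq> 0" "p \<noteq> 0" "q \<noteq> 0" for p q
      using that by (simp add: field_simps)
    have "z * deriv (\<lambda>z. disk_aut t z ^ n) z * cnj (z * disk_aut t z ^ n) / z
        = of_nat n * (1 / (1 - of_real t * z) + of_real t / (z - of_real t)) *
          (disk_aut t z ^ n * cnj (disk_aut t z ^ n)) * cnj z / z"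
      by (subst disk_aut_power_euler[OF t]) (use z disk_aut_radius pf in auto)
    also have "\<dots> = of_nat n * (1 / (z * (1 - of_real t * z)) + of_real t / (z * (z - of_real t))) / z"
      unfolding disk_aut_power_unimodular[OF z] cnj_eq_inverse_on_circle[OF z] using pf(3-5) by (simp add: divide_simps)
    also have "\<dots> = of_nat n * (of_real t / (z * (1 - of_real t * z)) + 1 / (z * (z - of_real t)))"
      unfolding pf(1,2) by (rule collect) (use pf(3-5) in auto)
    \<comment> \<open>Inserting \<open>t / t\<close> makes the second partial fraction identity
      applicable.\<close>
    also have "\<dots> = of_nat n * (of_real t * (1 / (z * (1 - of_real t * z)))
        + 1 / of_real t * (of_real t / (z * (z - of_real t))))"
      using t by simp
    also have "\<dots> = of_nat n * of_real t ^ 2 / (1 - of_real t * z)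
        + of_nat n * (of_real t - 1 / of_real t) / z + of_nat n / of_real t / (z - of_real t) + 0 / z ^ 2"
      unfolding pf(1,2) by (simp add: algebra_simps power2_eq_square diff_divide_distrib)
    finally show "of_nat n * of_real t ^ 2 / (1 - of_real t * z)
        + of_nat n * (of_real t - 1 / of_real t) / z + of_nat n / of_real t / (z - of_real t) + 0 / z ^ 2 =
      z * deriv (\<lambda>z. disk_aut t z ^ n) z * cnj (z * disk_aut t z ^ n) / z" ..
  next
    have "of_nat n * (of_real t - 1 / of_real t) + of_nat n / of_real t = complex_of_real (real n * t)"
      using t by (simp add: algebra_simps)
    then show "((\<lambda>z. of_nat n * of_real t ^ 2 / (1 - of_real t * z)
        + of_nat n * (of_real t - 1 / of_real t) / z + of_nat n / of_real t / (z - of_real t) + 0 / z ^ 2)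
        has_contour_integral 2 * of_real pi * \<i> * of_real (real n * t)) (circlepath 0 1)"
      using circle_integral_partial_fractions[OF t, of "of_nat n * of_real t ^ 2"
          "of_nat n * (of_real t - 1 / of_real t)" "of_nat n / of_real t" 0]
      by (simp only:)
  qed
  from sums_Suc_of_zero[OF this[unfolded taylor_coeff_euler[OF disk_aut_power_hol disk_aut_radius(2)]
        taylor_coeff_times_id[OF disk_aut_power_hol disk_aut_radius(2)]]]
  show ?thesis
    by (simp add: c_def)
qed

text \<open>The deviation k - n has mean 0 under the weights |c_k|^2, so the mean of |k - n| is
  twice the sum D that is to be bounded. AM-GM applied to the centred shift identity gives n t \<le>
  2 D + 1/2.\<close>

lemma disk_aut_power_low_mass: "(\<Sum>k\<le>n. (real n - real k) * (cmod (c k))\<^sup>2) \<ge> real n * t / 2 - 1 / 4"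
proof -
  define v where "v k = (cmod (c k))\<^sup>2" for k
  define u where "u k = \<bar>real k - real n\<bar> * v k" for k
  have v: "v sums 1" "(\<lambda>k. real k * v k) sums real n" "\<And>k. v k \<ge> 0"
    using disk_aut_power_norm_sums disk_aut_power_mean_sums by (auto simp: v_def [abs_def])
  \<comment> \<open>(k - n) v_k plus twice its negative part is |k - n| v_k, and the first summand
    has total 0.\<close>
  have "(\<lambda>k. (real k * v k - real n * v k) + 2 * (if k \<in> {..n} then (real n - real k) * v k else 0))
      sums ((real n - real n * 1) + 2 * (\<Sum>k\<le>n. (real n - real k) * v k))"
    by (intro sums_add sums_diff sums_mult v sums_If_finite_set) auto
  also have "(\<lambda>k. (real k * v k - real n * v k) + 2 * (if k \<in> {..n} then (real n - real k) * v k else 0)) = u"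
    by (rule ext) (auto simp: u_def algebra_simps abs_if)
  finally have u: "u sums (2 * (\<Sum>k\<le>n. (real n - real k) * v k))"
    by simp
  have u_Suc: "(\<lambda>k. u (Suc k)) sums (2 * (\<Sum>k\<le>n. (real n - real k) * v k) - u 0)"
    using u by (simp add: sums_Suc_iff)
  have u0: "u 0 \<ge> 0"
    using v(3) by (simp add: u_def)
  have bound: "(\<lambda>k. (u (Suc k) + u k + v k) / 2) sums
      ((2 * (\<Sum>k\<le>n. (real n - real k) * v k) - u 0 + 2 * (\<Sum>k\<le>n. (real n - real k) * v k) + 1) / 2)"
    by (intro sums_divide sums_add u u_Suc v)
  \<comment> \<open>Subtracting \<open>n\<close> times the vanishing shift sum centres the factor
    \<open>Suc k\<close> at \<open>n\<close>.\<close>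
  have "(\<lambda>k. of_nat (Suc k) * c (Suc k) * cnj (c k) - of_nat n * (c (Suc k) * cnj (c k)))
      sums (of_real (real n * t) - of_nat n * 0)"
    by (intro sums_diff sums_mult disk_aut_power_shift_mean_sums disk_aut_power_shift_sums)
  also have "(\<lambda>k. of_nat (Suc k) * c (Suc k) * cnj (c k) - of_nat n * (c (Suc k) * cnj (c k)))
      = (\<lambda>k. of_real (real (Suc k) - real n) * (c (Suc k) * cnj (c k)))"
    by (simp add: algebra_simps)
  finally have s: "(\<lambda>k. of_real (real (Suc k) - real n) * (c (Suc k) * cnj (c k))) sums of_real (real n * t)"
    by simp
  have le: "cmod (of_real (real (Suc k) - real n) * (c (Suc k) * cnj (c k))) \<le> (u (Suc k) + u k + v k) / 2" for k
  proof -
    define x where "x = \<bar>real (Suc k) - real n\<bar>"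
    have "2 * cmod (c (Suc k)) * cmod (c k) \<le> v (Suc k) + v k"
      unfolding v_def by (rule sum_squares_bound)
    then have "x * (2 * cmod (c (Suc k)) * cmod (c k)) \<le> x * (v (Suc k) + v k)"
      by (intro mult_left_mono) (auto simp: x_def)
    also have "\<dots> = u (Suc k) + x * v k"
      by (simp add: u_def x_def algebra_simps)
    \<comment> \<open>Replacing |k + 1 - n| by |k - n| + 1 costs one extra \<open>v k\<close>; these
      have total 1 and cause the 1/4 in the bound.\<close>
    also have "x * v k \<le> (\<bar>real k - real n\<bar> + 1) * v k"
      by (intro mult_right_mono v) (auto simp: x_def)
    also have "\<dots> = u k + v k"
      by (simp add: u_def algebra_simps)
    finally have "x * (2 * cmod (c (Suc k)) * cmod (c k)) \<le> u (Suc k) + u k + v k"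
      by simp
    moreover have "cmod (of_real (real (Suc k) - real n) * (c (Suc k) * cnj (c k)))
        = x * (2 * cmod (c (Suc k)) * cmod (c k)) / 2"
      by (simp only: norm_mult norm_of_real complex_mod_cnj x_def)
    ultimately show ?thesis
      by simp
  qed
  have "real n * t = cmod (of_real (real n * t))"
    using t by (simp add: norm_mult)
  also have "\<dots> \<le> (\<Sum>k. (u (Suc k) + u k + v k) / 2)"
    using norm_suminf_le[OF le sums_summable[OF bound]] sums_unique[OF s] by simp
  also have "\<dots> = (2 * (\<Sum>k\<le>n. (real n - real k) * v k) - u 0 + 2 * (\<Sum>k\<le>n. (real n - real k) * v k) + 1) / 2"
    by (rule sums_unique[OF bound, symmetric])
  finally show ?thesis
    using u0 unfolding v_def by simp
qed

end

section \<open>Power series of the automorphism and the symmetry of its matrix\<close>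

text \<open>The formal counterpart of \<open>disk_aut t\<close>, which makes the coefficients of its
  powers accessible to recurrences.\<close>

definition disk_aut_fps :: "real \<Rightarrow> complex fps" where
  "disk_aut_fps t = (fps_const (of_real t) - fps_X) * inverse (1 - fps_const (of_real t) * fps_X)"

lemma taylor_coeff_disk_aut_power:
  "taylor_coeff (\<lambda>z. disk_aut t z ^ n) k = fps_nth (disk_aut_fps t ^ n) k"
proof -
  have "(\<lambda>z. ((of_real t - z) * inverse (1 - of_real t * z)) ^ n) has_fps_expansion disk_aut_fps t ^ n"
    unfolding disk_aut_fps_def by (intro fps_expansion_intros) simp
  then show ?thesis
    by (simp add: taylor_coeff_eq_fps_nth disk_aut_def divide_inverse)
qed

text \<open>Multiply \<phi> (1 - t z) = t - z by F \<phi>^n and compare coefficients. The factor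
  \<open>F\<close> covers both \<phi>^n itself and z \<phi>' \<phi>^n.\<close>

lemma disk_aut_fps_recurrence:
  fixes F :: "complex fps"
  shows "fps_nth (F * disk_aut_fps t ^ Suc n) (Suc k) =
    of_real t * fps_nth (F * disk_aut_fps t ^ Suc n) k +
    of_real t * fps_nth (F * disk_aut_fps t ^ n) (Suc k) - fps_nth (F * disk_aut_fps t ^ n) k"
proof -
  define A where "A = F * disk_aut_fps t ^ Suc n"
  define B where "B = F * disk_aut_fps t ^ n"
  have "inverse (1 - fps_const (of_real t) * fps_X) * (1 - fps_const (of_real t) * fps_X) = (1 :: complex fps)"
    by (rule inverse_mult_eq_1) simp
  then have "disk_aut_fps t * (1 - fps_const (of_real t) * fps_X) = fps_const (of_real t) - fps_X"
    by (simp add: disk_aut_fps_def mult.assoc)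
  then have "A * (1 - fps_const (of_real t) * fps_X) = B * (fps_const (of_real t) - fps_X)"
    unfolding A_def B_def power_Suc2 mult.assoc by simp
  then have "A - fps_const (of_real t) * (fps_X * A) = fps_const (of_real t) * B - fps_X * B"
    by (simp add: algebra_simps)
  then have "fps_nth (A - fps_const (of_real t) * (fps_X * A)) (Suc k) =
      fps_nth (fps_const (of_real t) * B - fps_X * B) (Suc k)"
    by simp
  then have "fps_nth A (Suc k) - of_real t * fps_nth A k = of_real t * fps_nth B (Suc k) - fps_nth B k"
    by simp
  then show ?thesis
    unfolding A_def [symmetric] B_def [symmetric] by (simp only: diff_eq_eq) (simp add: algebra_simps)
qed

lemma disk_aut_fps_nth_0: "fps_nth (disk_aut_fps t ^ n) 0 = of_real t ^ n"
  by (simp add: disk_aut_fps_def fps_nth_power_0)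

lemma disk_aut_fps_nth_Suc: "fps_nth (disk_aut_fps t) (Suc k) = of_real t ^ k * (of_real t ^ 2 - 1)"
proof (induction k)
  case 0
  then show ?case
    using disk_aut_fps_recurrence[of 1 t 0 0] disk_aut_fps_nth_0[of t 1] by (simp add: power2_eq_square)
next
  case (Suc k)
  then show ?case
    using disk_aut_fps_recurrence[of 1 t 0 "Suc k"] by simp
qed

text \<open>With the coefficients of \<phi> itself, this supplies the boundary values of the double
  induction below.\<close>

lemma disk_aut_fps_power_nth_1:
  "fps_nth (disk_aut_fps t ^ Suc n) 1 = of_nat (Suc n) * of_real t ^ n * (of_real t ^ 2 - 1)"
proof (induction n)
  case 0
  then show ?case
    using disk_aut_fps_nth_Suc[of t 0] by simp
next
  case (Suc n)
  have "fps_nth (disk_aut_fps t ^ Suc (Suc n)) 1 =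
      of_real t * of_real t ^ Suc (Suc n) +
      of_real t * fps_nth (disk_aut_fps t ^ Suc n) 1 - of_real t ^ Suc n"
    using disk_aut_fps_recurrence[of 1 t "Suc n" 0]
    by (simp only: disk_aut_fps_nth_0 mult_1 One_nat_def)
  then show ?case
    unfolding Suc by (simp add: algebra_simps power2_eq_square)
qed

text \<open>As arrays in \<open>n\<close> and \<open>k\<close>, both sides obey the recurrence
  above, which is unchanged when the two indices are exchanged. They agree for \<open>n = 0\<close>
  by the two closed forms, and both vanish for \<open>k = 0\<close>.\<close>

lemma disk_aut_fps_euler_nth:
  "fps_nth (fps_X * fps_deriv (disk_aut_fps t) * disk_aut_fps t ^ n) k = fps_nth (disk_aut_fps t ^ k) (Suc n)"
proof (induction n arbitrary: k)
  case 0
  then show ?case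
    using disk_aut_fps_nth_Suc[of t] disk_aut_fps_power_nth_1[of t]
    by (cases k) (simp_all del: power_Suc)
next
  case (Suc n)
  show ?case
  proof (induction k)
    case 0
    then show ?case by (simp add: mult.assoc)
  next
    case (Suc k)
    then show ?case
      using disk_aut_fps_recurrence[of "fps_X * fps_deriv (disk_aut_fps t)" t n k]
        disk_aut_fps_recurrence[of 1 t k "Suc n"]
      by (simp only: \<open>\<And>k. _ = fps_nth (disk_aut_fps t ^ k) (Suc n)\<close> mult_1 add.commute)
  qed
qed

text \<open>This is the unitarity of \<open>C\<^bsub>\<phi>\<^esub>\<close> on the Dirichlet space combined with \<open>\<phi> \<circ> \<phi> = id\<close>.\<close>

lemma taylor_coeff_disk_aut_symmetry:
  "of_nat k * taylor_coeff (\<lambda>z. disk_aut t z ^ n) k = of_nat n * taylor_coeff (\<lambda>z. disk_aut t z ^ k) n"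
proof (cases n)
  case 0
  then show ?thesis
    unfolding taylor_coeff_disk_aut_power by (cases k) simp_all
next
  case (Suc m)
  have "fps_X * fps_deriv (disk_aut_fps t ^ Suc m) =
      of_nat (Suc m) * (fps_X * fps_deriv (disk_aut_fps t) * disk_aut_fps t ^ m)"
    by (subst fps_deriv_power) (simp add: mult_ac fps_of_nat del: of_nat_Suc)
  then have "fps_nth (fps_X * fps_deriv (disk_aut_fps t ^ Suc m)) k =
      of_nat (Suc m) * fps_nth (disk_aut_fps t ^ k) (Suc m)"
    by (simp only: fps_mult_of_nat_nth disk_aut_fps_euler_nth)
  then show ?thesis
    unfolding Suc taylor_coeff_disk_aut_power
    by (cases k) (simp_all del: power_Suc of_nat_Suc)
qed

section \<open>Growth of the comparison weights and the weighted low mass\<close>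

lemma beta_alpha_pos: "\<alpha> \<ge> 0 \<Longrightarrow> beta_alpha \<alpha> k > 0"
  unfolding beta_alpha_def weight_prod_def by (intro prod_pos) auto

lemma weight_prod_Suc: "weight_prod w (Suc k) = weight_prod w k * w (Suc k)"
  by (simp add: weight_prod_def)

lemma weight_prod_pos: "(\<And>k. k \<ge> 1 \<Longrightarrow> w k > 0) \<Longrightarrow> weight_prod w k > 0"
  unfolding weight_prod_def by (intro prod_pos) auto

lemma beta_alpha_Suc:
  "beta_alpha \<alpha> (Suc k) = beta_alpha \<alpha> k * sqrt ((real k + 2) / (real k + 2 * \<alpha> + 2))"
  by (simp add: beta_alpha_def weight_prod_Suc algebra_simps)

text \<open>The squared ratio is the product of (m + 2 \<alpha>) / m for m from k + 2 to n + 1, and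
  each factor is at least (1 + 2/m) (1 + (\<alpha> - 1)/m). The parts 1 + 2/m telescope to a
  quotient of order (n/k)^2, which later pays for a factor (k/n)^2. A bound \<open>N\<close>
  separate from \<open>n\<close> keeps the base of the power fixed during the induction.\<close>

lemma beta_alpha_ratio_power:
  assumes "\<alpha> \<ge> 1" "k \<le> n" "n \<le> N"
  shows "(real n + 2) * (real n + 3) / ((real k + 2) * (real k + 3)) * (1 + (\<alpha> - 1) / (real N + 1)) ^ (n - k)
    \<le> (beta_alpha \<alpha> k / beta_alpha \<alpha> n)\<^sup>2"
  using assms(2,3)
proof (induction n rule: dec_induct)
  case base
  then show ?case
    using beta_alpha_pos[of \<alpha> k] assms(1) by simp
next
  case (step n)
  define m where "m = real n + 2"
  define q where "q = 1 + (\<alpha> - 1) / (real N + 1)"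
  define R where "R = (beta_alpha \<alpha> k / beta_alpha \<alpha> n)\<^sup>2"
  have m: "m \<ge> 2" "m \<le> real N + 1"
    using step by (auto simp: m_def)
  \<comment> \<open>Expanded, this is
    \<open>2 * (\<alpha> - 1) \<le> m * (\<alpha> - 1)\<close>.\<close>
  have "(m + 2) * (m + (\<alpha> - 1)) \<le> m * (m + 2 * \<alpha>)"
    using mult_right_mono[OF m(1), of "\<alpha> - 1"] assms(1) by (simp add: algebra_simps)
  then have "(m + 2) * (m + (\<alpha> - 1)) / (m * m) \<le> m * (m + 2 * \<alpha>) / (m * m)"
    by (intro divide_right_mono) auto
  also have "(m + (\<alpha> - 1)) / m = 1 + (\<alpha> - 1) / m"
    using m unfolding add_divide_distrib[of m] by simp
  then have "(m + 2) * (m + (\<alpha> - 1)) / (m * m) = (m + 2) / m * (1 + (\<alpha> - 1) / m)"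
    by (metis times_divide_times_eq)
  also have "m * (m + 2 * \<alpha>) / (m * m) = (m + 2 * \<alpha>) / m"
    using m by simp
  finally have "(m + 2) / m * (1 + (\<alpha> - 1) / m) \<le> (m + 2 * \<alpha>) / m" .
  moreover have "q \<le> 1 + (\<alpha> - 1) / m"
    unfolding q_def using m assms(1) by (intro add_left_mono divide_left_mono) auto
  then have "(m + 2) / m * q \<le> (m + 2) / m * (1 + (\<alpha> - 1) / m)"
    using m by (intro mult_left_mono) auto
  ultimately have q: "(m + 2) / m * q \<le> (m + 2 * \<alpha>) / m"
    by linarith
  have q0: "q \<ge> 0"
    using assms(1) by (simp add: q_def)
  have IH: "(real n + 2) * (real n + 3) / ((real k + 2) * (real k + 3)) * q ^ (n - k) \<le> R"
    using step by (simp add: q_def R_def)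
  have "(real (Suc n) + 2) * (real (Suc n) + 3) / ((real k + 2) * (real k + 3)) * q ^ (Suc n - k)
      = ((real n + 2) * (real n + 3) / ((real k + 2) * (real k + 3)) * q ^ (n - k)) * ((m + 2) / m * q)"
    using step(1) by (simp add: Suc_diff_le m_def divide_simps)
  also have "\<dots> \<le> R * ((m + 2 * \<alpha>) / m)"
    using IH q m q0 by (intro mult_mono) (auto simp: R_def)
  also have "\<dots> = (beta_alpha \<alpha> k / beta_alpha \<alpha> (Suc n))\<^sup>2"
    using m assms(1) beta_alpha_pos[of \<alpha> n]
    by (simp add: R_def beta_alpha_Suc power_divide power_mult_distrib m_def algebra_simps)
  finally show ?case
    by (simp add: q_def)
qed

text \<open>The factor \<open>(k / n)\<^sup>2\<close> accommodates the transposed matrix of \<open>C\<^bsub>\<phi>\<^esub>\<close>.\<close>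

lemma beta_alpha_ratio_ge:
  assumes "\<alpha> \<ge> 1" "1 \<le> k" "k \<le> n"
  shows "(\<alpha> - 1) / (12 * (real n + 1)) * (real n - real k) \<le>
    (real k / real n)\<^sup>2 * (beta_alpha \<alpha> k / beta_alpha \<alpha> n)\<^sup>2"
proof -
  define x where "x = (\<alpha> - 1) / (real n + 1)"
  have x: "x \<ge> 0"
    using assms by (simp add: x_def)
  have "(real n - real k) * x \<le> 1 + real (n - k) * x"
    using assms by (simp add: of_nat_diff)
  also have "\<dots> \<le> (1 + x) ^ (n - k)"
    using x by (intro Bernoulli_inequality) auto
  finally have 1: "(real n - real k) * x \<le> (1 + x) ^ (n - k)" .
  \<comment> \<open>For \<open>k \<ge> 1\<close>, k + 2 \<le> 3 k and k + 3 \<le> 4 k; hence the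
    constant 12.\<close>
  have k: "(real k + 2) * (real k + 3) \<le> 12 * (real k)\<^sup>2"
  proof -
    have "(real k + 2) * (real k + 3) \<le> (3 * real k) * (4 * real k)"
      using assms by (intro mult_mono) auto
    then show ?thesis
      by (simp add: power2_eq_square)
  qed
  have "(real n)\<^sup>2 * ((real k + 2) * (real k + 3)) \<le> ((real n + 2) * (real n + 3)) * (12 * (real k)\<^sup>2)"
    by (intro mult_mono k) (simp_all add: power2_eq_square algebra_simps)
  then have "1 / 12 \<le> (real k / real n)\<^sup>2 * ((real n + 2) * (real n + 3) / ((real k + 2) * (real k + 3)))"
    using assms by (simp add: power_divide divide_simps) (simp add: algebra_simps)
  then have "1 / 12 * ((real n - real k) * x) \<le>
      ((real k / real n)\<^sup>2 * ((real n + 2) * (real n + 3) / ((real k + 2) * (real k + 3)))) * (1 + x) ^ (n - k)"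
    using 1 x assms by (intro mult_mono) auto
  also have "\<dots> = (real k / real n)\<^sup>2 *
      ((real n + 2) * (real n + 3) / ((real k + 2) * (real k + 3)) * (1 + x) ^ (n - k))"
    by (simp only: mult.assoc)
  also have "\<dots> \<le> (real k / real n)\<^sup>2 * (beta_alpha \<alpha> k / beta_alpha \<alpha> n)\<^sup>2"
    unfolding x_def using beta_alpha_ratio_power[of \<alpha> k n n] assms by (intro mult_left_mono) auto
  finally show ?thesis
    by (simp add: x_def mult.commute)
qed

text \<open>The pointwise bound on the weights turns the low mass into a multiple of \<alpha> - 1.
  Hypothesis \<open>large\<close> absorbs the 1/4 and the term at \<open>k = 0\<close>, leaving n t
  / 4. With the factor (k/n)^2 the same sum serves both spaces.\<close>

lemma weighted_low_mass:
  assumes t: "0 < t" "t < 1" and n: "n \<ge> 1" and \<alpha>: "\<alpha> \<ge> 1"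
    and b: "\<And>k. k \<le> n \<Longrightarrow> b n / b k \<ge> beta_alpha \<alpha> k / beta_alpha \<alpha> n"
    and large: "1 / (4 * real n) + t ^ (2 * n) \<le> t / 4"
  shows "(\<alpha> - 1) * t / 96 \<le>
    (\<Sum>k\<le>n. (real k / real n)\<^sup>2 * (cmod (taylor_coeff (\<lambda>z. disk_aut t z ^ n) k))\<^sup>2 * (b n / b k)\<^sup>2)"
proof -
  define v where "v k = (cmod (taylor_coeff (\<lambda>z. disk_aut t z ^ n) k))\<^sup>2" for k
  define A where "A = (\<alpha> - 1) / (12 * (real n + 1))"
  have A: "A \<ge> 0"
    using \<alpha> by (simp add: A_def)
  \<comment> \<open>The term at \<open>k = 0\<close> has to be split off: its factor (k/n)^2
    vanishes, while it contributes \<open>n * t ^ (2 * n)\<close> to the low mass.\<close>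
  have v0: "v 0 = t ^ (2 * n)"
    using t by (simp add: v_def taylor_coeff_disk_aut_power disk_aut_fps_nth_0 norm_power power_mult mult.commute)
  have "real n * (t / 4) \<le> real n * (t / 2 - 1 / (4 * real n) - t ^ (2 * n))"
    using large by (intro mult_left_mono) auto
  also have "\<dots> = real n * t / 2 - 1 / 4 - real n * v 0"
    using n by (simp add: v0 algebra_simps)
  also have "\<dots> \<le> (\<Sum>k\<le>n. (real n - real k) * v k) - real n * v 0"
    using disk_aut_power_low_mass[OF t, of n] by (simp add: v_def)
  also have "\<dots> = (\<Sum>k\<in>{..n} - {0}. (real n - real k) * v k)"
    by (simp add: sum_diff1)
  finally have low: "real n * (t / 4) \<le> (\<Sum>k\<in>{..n} - {0}. (real n - real k) * v k)" .
  \<comment> \<open>The constant 1/96 collects 1/12 from \<open>A\<close>, 1/4 from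
    \<open>low\<close> and this 1/2.\<close>
  have "1 / 2 \<le> real n / (real n + 1)"
    using n by (simp add: field_simps)
  then have "(\<alpha> - 1) * t / 48 * (1 / 2) \<le> (\<alpha> - 1) * t / 48 * (real n / (real n + 1))"
    using \<alpha> t by (intro mult_left_mono) auto
  also have "\<dots> = A * (real n * (t / 4))"
    by (simp add: A_def field_simps)
  also have "\<dots> \<le> A * (\<Sum>k\<in>{..n} - {0}. (real n - real k) * v k)"
    by (intro mult_left_mono low A)
  also have "\<dots> = (\<Sum>k\<in>{..n} - {0}. A * (real n - real k) * v k)"
    by (simp add: sum_distrib_left mult.assoc)
  also have "\<dots> \<le> (\<Sum>k\<in>{..n} - {0}. (real k / real n)\<^sup>2 * v k * (b n / b k)\<^sup>2)"
  proof (rule sum_mono)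
    fix k assume "k \<in> {..n} - {0}"
    then have k: "1 \<le> k" "k \<le> n" by auto
    have "0 < beta_alpha \<alpha> k / beta_alpha \<alpha> n"
      using beta_alpha_pos[of \<alpha>] \<alpha> by simp
    then have "(beta_alpha \<alpha> k / beta_alpha \<alpha> n)\<^sup>2 \<le> (b n / b k)\<^sup>2"
      using b[OF k(2)] by (intro power_mono) auto
    then have "(real k / real n)\<^sup>2 * (beta_alpha \<alpha> k / beta_alpha \<alpha> n)\<^sup>2 \<le> (real k / real n)\<^sup>2 * (b n / b k)\<^sup>2"
      by (intro mult_left_mono) auto
    then have "A * (real n - real k) \<le> (real k / real n)\<^sup>2 * (b n / b k)\<^sup>2"
      using beta_alpha_ratio_ge[OF \<alpha> k] unfolding A_def by linarith
    then have "A * (real n - real k) * v k \<le> (real k / real n)\<^sup>2 * (b n / b k)\<^sup>2 * v k"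
      by (rule mult_right_mono) (simp add: v_def)
    then show "A * (real n - real k) * v k \<le> (real k / real n)\<^sup>2 * v k * (b n / b k)\<^sup>2"
      by (simp add: mult_ac)
  qed
  also have "\<dots> \<le> (\<Sum>k\<le>n. (real k / real n)\<^sup>2 * v k * (b n / b k)\<^sup>2)"
    by (rule sum_mono2) (auto simp: v_def)
  finally show ?thesis
    by (simp add: v_def)
qed

section \<open>Norm estimates in weighted Hardy spaces\<close>

lemma monomial_in_weighted_hardy: "(\<lambda>z. z ^ n) \<in> weighted_hardy \<gamma>"
  and hardy_norm_monomial: "(hardy_norm \<gamma> (\<lambda>z. z ^ n))\<^sup>2 = (\<gamma> n)\<^sup>2"
proof -
  have "(\<lambda>k. if k = n then (\<gamma> k)\<^sup>2 else 0) sums (\<gamma> n)\<^sup>2"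
    by (rule sums_single)
  also have "(\<lambda>k. if k = n then (\<gamma> k)\<^sup>2 else 0) =
      (\<lambda>k. (cmod (taylor_coeff (\<lambda>z. z ^ n) k))\<^sup>2 * (\<gamma> k)\<^sup>2)"
    by (auto simp: taylor_coeff_monomial)
  finally have s: "(\<lambda>k. (cmod (taylor_coeff (\<lambda>z. z ^ n) k))\<^sup>2 * (\<gamma> k)\<^sup>2) sums (\<gamma> n)\<^sup>2" .
  show "(\<lambda>z. z ^ n) \<in> weighted_hardy \<gamma>"
    using s by (auto simp: weighted_hardy_def sums_iff intro!: holomorphic_intros)
  show "(hardy_norm \<gamma> (\<lambda>z. z ^ n))\<^sup>2 = (\<gamma> n)\<^sup>2"
    using s by (simp add: hardy_norm_def sums_iff)
qed

lemma sum_le_hardy_norm_squared: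
  assumes "f \<in> weighted_hardy \<gamma>" "finite A"
  shows "(\<Sum>k\<in>A. (cmod (taylor_coeff f k))\<^sup>2 * (\<gamma> k)\<^sup>2) \<le> (hardy_norm \<gamma> f)\<^sup>2"
proof -
  have summable: "summable (\<lambda>k. (cmod (taylor_coeff f k))\<^sup>2 * (\<gamma> k)\<^sup>2)"
    using assms by (simp add: weighted_hardy_def)
  show ?thesis
    unfolding hardy_norm_def using sum_le_suminf[OF summable assms(2)] suminf_nonneg[OF summable]
    by simp
qed

lemma bounded_composition_op_squared:
  assumes "bounded_composition_op \<gamma> \<phi>"
  obtains C where "C \<ge> 0" "\<And>f. f \<in> weighted_hardy \<gamma> \<Longrightarrow> f \<circ> \<phi> \<in> weighted_hardy \<gamma>"
    "\<And>f. f \<in> weighted_hardy \<gamma> \<Longrightarrow> (hardy_norm \<gamma> (f \<circ> \<phi>))\<^sup>2 \<le> C * (hardy_norm \<gamma> f)\<^sup>2"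
proof -
  from assms obtain C where
    C: "\<And>f. f \<in> weighted_hardy \<gamma> \<Longrightarrow> hardy_norm \<gamma> (f \<circ> \<phi>) \<le> C * hardy_norm \<gamma> f"
    and mem: "\<And>f. f \<in> weighted_hardy \<gamma> \<Longrightarrow> f \<circ> \<phi> \<in> weighted_hardy \<gamma>"
    unfolding bounded_composition_op_def by blast
  have "(hardy_norm \<gamma> (f \<circ> \<phi>))\<^sup>2 \<le> C\<^sup>2 * (hardy_norm \<gamma> f)\<^sup>2" if "f \<in> weighted_hardy \<gamma>" for f
  proof -
    \<comment> \<open>Squaring needs a nonnegative left side; membership gives the summability
      behind it.\<close>
    have "0 \<le> hardy_norm \<gamma> (f \<circ> \<phi>)"
      using mem[OF that] by (auto simp: hardy_norm_def weighted_hardy_def intro!: suminf_nonneg)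
    then show ?thesis
      using power_mono[OF C[OF that], of 2] by (simp add: power_mult_distrib)
  qed
  then show ?thesis
    using that[of "C\<^sup>2"] mem by simp
qed

text \<open>Test on monomials: z^n composed with \<phi> is \<phi>^n, whose norm is then truncated at
  degree \<open>n\<close>.\<close>

lemma bounded_composition_op_rows:
  assumes "bounded_composition_op \<gamma> \<phi>"
  obtains C where
    "\<And>n. (\<Sum>k\<le>n. (cmod (taylor_coeff (\<lambda>z. \<phi> z ^ n) k))\<^sup>2 * (\<gamma> k)\<^sup>2) \<le> C * (\<gamma> n)\<^sup>2"
proof -
  obtain C where C: "\<And>f. f \<in> weighted_hardy \<gamma> \<Longrightarrow> f \<circ> \<phi> \<in> weighted_hardy \<gamma>"
    "\<And>f. f \<in> weighted_hardy \<gamma> \<Longrightarrow> (hardy_norm \<gamma> (f \<circ> \<phi>))\<^sup>2 \<le> C * (hardy_norm \<gamma> f)\<^sup>2"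
    using bounded_composition_op_squared[OF assms] by metis
  have "(\<Sum>k\<le>n. (cmod (taylor_coeff (\<lambda>z. \<phi> z ^ n) k))\<^sup>2 * (\<gamma> k)\<^sup>2) \<le> C * (\<gamma> n)\<^sup>2" for n
    using sum_le_hardy_norm_squared[OF C(1)[OF monomial_in_weighted_hardy[of n]], of "{..n}"]
      C(2)[OF monomial_in_weighted_hardy[of n]]
    by (simp add: hardy_norm_monomial comp_def)
  then show ?thesis
    using that by blast
qed

lemma finite_taylor_hardy_norm:
  assumes "f holomorphic_on ball 0 1" "finite A" "\<And>k. k \<notin> A \<Longrightarrow> taylor_coeff f k = 0"
  shows "f \<in> weighted_hardy \<gamma>"
    and "(hardy_norm \<gamma> f)\<^sup>2 = (\<Sum>k\<in>A. (cmod (taylor_coeff f k))\<^sup>2 * (\<gamma> k)\<^sup>2)"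
proof -
  have s: "(\<lambda>k. (cmod (taylor_coeff f k))\<^sup>2 * (\<gamma> k)\<^sup>2) sums
      (\<Sum>k\<in>A. (cmod (taylor_coeff f k))\<^sup>2 * (\<gamma> k)\<^sup>2)"
    by (rule sums_finite) (use assms in auto)
  show "f \<in> weighted_hardy \<gamma>"
    using s assms(1) by (auto simp: weighted_hardy_def sums_iff)
  show "(hardy_norm \<gamma> f)\<^sup>2 = (\<Sum>k\<in>A. (cmod (taylor_coeff f k))\<^sup>2 * (\<gamma> k)\<^sup>2)"
    using s by (simp add: hardy_norm_def sums_iff sum_nonneg)
qed

text \<open>Boundedness of the transposed matrix on the dual space: the test polynomial is the one for
  which the Cauchy--Schwarz inequality in the \<open>n\<close>-th coefficient is sharp.\<close>

lemma bounded_composition_op_columns: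
  assumes "bounded_composition_op \<gamma> \<phi>" "\<phi> holomorphic_on ball 0 1" and \<gamma>: "\<And>k. \<gamma> k > 0"
  obtains C where
    "\<And>n. (\<Sum>k\<le>n. (cmod (taylor_coeff (\<lambda>z. \<phi> z ^ k) n))\<^sup>2 / (\<gamma> k)\<^sup>2) \<le> C / (\<gamma> n)\<^sup>2"
proof -
  obtain C where C0: "C \<ge> 0" and C: "\<And>f. f \<in> weighted_hardy \<gamma> \<Longrightarrow> f \<circ> \<phi> \<in> weighted_hardy \<gamma>"
    "\<And>f. f \<in> weighted_hardy \<gamma> \<Longrightarrow> (hardy_norm \<gamma> (f \<circ> \<phi>))\<^sup>2 \<le> C * (hardy_norm \<gamma> f)\<^sup>2"
    using bounded_composition_op_squared[OF assms(1)] by metis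
  have "(\<Sum>k\<le>n. (cmod (taylor_coeff (\<lambda>z. \<phi> z ^ k) n))\<^sup>2 / (\<gamma> k)\<^sup>2) \<le> C / (\<gamma> n)\<^sup>2" for n
  proof -
    define a where "a k = taylor_coeff (\<lambda>z. \<phi> z ^ k) n" for k
    define x where "x k = cnj (a k) / of_real ((\<gamma> k)\<^sup>2)" for k
    define S where "S = (\<Sum>k\<le>n. (cmod (a k))\<^sup>2 / (\<gamma> k)\<^sup>2)"
    define p where "p z = (\<Sum>k\<le>n. x k * z ^ k)" for z
    have S0: "S \<ge> 0"
      by (simp add: S_def sum_nonneg)
    have p_hol: "p holomorphic_on ball 0 1"
      unfolding p_def by (intro holomorphic_intros)
    have p_coeff: "taylor_coeff p k = (if k \<le> n then x k else 0)" for k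
    proof -
      have "taylor_coeff p k = (\<Sum>i\<le>n. x i * taylor_coeff (\<lambda>z. z ^ i) k)"
        unfolding p_def by (rule taylor_coeff_sum[of _ _ 1]) (auto intro!: holomorphic_intros)
      then show ?thesis
        by (simp add: taylor_coeff_monomial if_distrib cong: if_cong)
    qed
    have p_mem: "p \<in> weighted_hardy \<gamma>"
      by (rule finite_taylor_hardy_norm(1)[OF p_hol, of "{..n}"]) (auto simp: p_coeff)
    have "(hardy_norm \<gamma> p)\<^sup>2 = (\<Sum>k\<le>n. (cmod (x k))\<^sup>2 * (\<gamma> k)\<^sup>2)"
      by (subst finite_taylor_hardy_norm(2)[OF p_hol, of "{..n}"]) (auto simp: p_coeff)
    also have "\<dots> = S"
      unfolding S_def
    proof (rule sum.cong)
      fix k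
      have "cmod (x k) = cmod (a k) / (\<gamma> k)\<^sup>2" "\<gamma> k \<noteq> 0"
        using \<gamma>[of k] by (simp_all add: x_def norm_divide norm_power)
      then show "(cmod (x k))\<^sup>2 * (\<gamma> k)\<^sup>2 = (cmod (a k))\<^sup>2 / (\<gamma> k)\<^sup>2"
        by (simp add: power_divide power2_eq_square)
    qed simp
    finally have p_norm: "(hardy_norm \<gamma> p)\<^sup>2 = S" .
    have "taylor_coeff (\<lambda>z. \<Sum>k\<le>n. x k * \<phi> z ^ k) n = (\<Sum>k\<le>n. x k * a k)"
      unfolding a_def by (rule taylor_coeff_sum[of _ _ 1]) (auto intro!: holomorphic_intros assms(2))
    also have "\<dots> = (\<Sum>k\<le>n. of_real ((cmod (a k))\<^sup>2 / (\<gamma> k)\<^sup>2))"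
      unfolding x_def of_real_divide complex_norm_square by (simp add: mult.commute)
    also have "\<dots> = of_real S"
      by (simp add: S_def)
    finally have coeff: "taylor_coeff (p \<circ> \<phi>) n = of_real S"
      by (simp add: p_def comp_def)
    \<comment> \<open>Keeping only the coefficient \<open>n\<close> gives a lower bound quadratic in
      \<open>S\<close>, against an upper bound linear in \<open>S\<close>.\<close>
    have "S * S * (\<gamma> n)\<^sup>2 = (\<Sum>k\<in>{n}. (cmod (taylor_coeff (p \<circ> \<phi>) k))\<^sup>2 * (\<gamma> k)\<^sup>2)"
      using S0 by (simp add: coeff power2_eq_square)
    also have "\<dots> \<le> (hardy_norm \<gamma> (p \<circ> \<phi>))\<^sup>2"
      by (rule sum_le_hardy_norm_squared[OF C(1)[OF p_mem]]) simp
    also have "\<dots> \<le> C * S"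
      using C(2)[OF p_mem] by (simp add: p_norm)
    finally have SS: "S * (S * (\<gamma> n)\<^sup>2) \<le> S * C"
      by (simp add: mult_ac)
    \<comment> \<open>For \<open>S = 0\<close> the claim reads 0 \<le> C, hence the nonnegative
      choice of \<open>C\<close>.\<close>
    have "S * (\<gamma> n)\<^sup>2 \<le> C"
    proof (cases "S = 0")
      case False
      then show ?thesis
        using SS S0 by simp
    qed (use C0 in simp)
    then show ?thesis
      using \<gamma>[of n] by (simp add: S_def a_def [symmetric] pos_le_divide_eq)
  qed
  then show ?thesis
    using that by blast
qed

text \<open>\<phi>^n is analytic on a disk of radius \<open>1 / t\<close> > 1, so its coefficients
  decay geometrically, while quotients of consecutive weights tend to 1. Membership is what lets
  partial sums bound the norm of \<phi>^n from below.\<close>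

lemma disk_aut_power_in_weighted_hardy:
  assumes t: "0 < t" "t < 1" and w: "\<And>k. k \<ge> 1 \<Longrightarrow> w k > 0" "w \<longlonglongrightarrow> 1"
  shows "(\<lambda>z. disk_aut t z ^ n) \<in> weighted_hardy (\<lambda>k. 1 / weight_prod w k)"
proof -
  note hol = disk_aut_power_holomorphic[OF t(1), of n]
  obtain s where s: "1 < s" "s < 1 / t"
    using dense[of 1 "1 / t"] t by auto
  then obtain C where C: "\<And>k. cmod (taylor_coeff (\<lambda>z. disk_aut t z ^ n) k) \<le> C * (1 / s) ^ k"
    using taylor_coeff_bound[OF hol _ s(2)] by (metis less_trans zero_less_one)
  \<comment> \<open>\<open>q\<close> separates 1 from \<open>1 / s\<close>, the limit of the
    quotients of the sequence \<open>b\<close> below.\<close>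
  obtain q where q: "1 / s < q" "q < 1"
    using dense[of "1 / s" 1] s by auto
  have q0: "q > 0"
    using q(1) s(1) by (meson less_trans zero_less_divide_1_iff zero_less_one)
  have lim: "(\<lambda>k. 1 / s * (1 / w (Suc k))) \<longlonglongrightarrow> 1 / s * (1 / 1)"
    by (intro tendsto_intros LIMSEQ_Suc w) simp
  have "eventually (\<lambda>k. 1 / s * (1 / w (Suc k)) < q) sequentially"
    by (rule order_tendstoD(2)[OF lim]) (use q in simp)
  then obtain N where N: "\<And>k. k \<ge> N \<Longrightarrow> 1 / s * (1 / w (Suc k)) < q"
    by (auto simp: eventually_sequentially)
  define b where "b k = (1 / s) ^ k * (1 / weight_prod w k)" for k
  have b_pos: "b k > 0" for k
    using s weight_prod_pos[of w k] w by (simp add: b_def)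
  have b_Suc: "b (Suc k) = 1 / s * (1 / w (Suc k)) * b k" for k
    by (simp add: b_def weight_prod_Suc)
  have "summable (\<lambda>k. (b k)\<^sup>2)"
  proof (rule summable_ratio_test[of "q\<^sup>2" N])
    show "q\<^sup>2 < 1"
      using q q0 by (simp add: power_less_one_iff)
    fix k assume "k \<ge> N"
    then have "b (Suc k) \<le> q * b k"
      unfolding b_Suc using N[of k] b_pos[of k] by (intro mult_right_mono) auto
    then have "(b (Suc k))\<^sup>2 \<le> (q * b k)\<^sup>2"
      using b_pos[of "Suc k"] by (intro power_mono) auto
    then show "norm ((b (Suc k))\<^sup>2) \<le> q\<^sup>2 * norm ((b k)\<^sup>2)"
      by (simp add: power_mult_distrib)
  qed
  then have "summable (\<lambda>k. C\<^sup>2 * (b k)\<^sup>2)"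
    by (rule summable_mult)
  then have "summable (\<lambda>k. (cmod (taylor_coeff (\<lambda>z. disk_aut t z ^ n) k))\<^sup>2 * (1 / weight_prod w k)\<^sup>2)"
  proof (rule summable_comparison_test'[where N = 0])
    fix k
    have "(cmod (taylor_coeff (\<lambda>z. disk_aut t z ^ n) k))\<^sup>2 \<le> (C * (1 / s) ^ k)\<^sup>2"
      by (intro power_mono C) simp
    then have "(cmod (taylor_coeff (\<lambda>z. disk_aut t z ^ n) k))\<^sup>2 * (1 / weight_prod w k)\<^sup>2
        \<le> (C * (1 / s) ^ k)\<^sup>2 * (1 / weight_prod w k)\<^sup>2"
      by (rule mult_right_mono) simp
    also have "\<dots> = C\<^sup>2 * (b k)\<^sup>2"
      by (simp only: b_def power_mult_distrib mult.assoc)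
    finally show "norm ((cmod (taylor_coeff (\<lambda>z. disk_aut t z ^ n) k))\<^sup>2 * (1 / weight_prod w k)\<^sup>2)
        \<le> C\<^sup>2 * (b k)\<^sup>2"
      by simp
  qed
  moreover have "(\<lambda>z. disk_aut t z ^ n) holomorphic_on ball 0 1"
    by (rule holomorphic_on_subset[OF hol]) (use s in auto)
  ultimately show ?thesis
    by (simp add: weighted_hardy_def)
qed

section \<open>Unboundedness under the domination hypothesis\<close>

lemma low_mass_threshold:
  assumes "0 < t" "t < (1::real)"
  shows "\<forall>\<^sub>F n in sequentially. 1 / (4 * real n) + t ^ (2 * n) \<le> t / 4"
proof -
  have "(\<lambda>n. 1 / 4 * (1 / real n) + (t\<^sup>2) ^ n) \<longlonglongrightarrow> 1 / 4 * 0 + 0"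
    by (intro tendsto_intros lim_1_over_n LIMSEQ_realpow_zero)
       (use assms in \<open>auto simp: power_less_one_iff\<close>)
  then have "\<forall>\<^sub>F n in sequentially. 1 / 4 * (1 / real n) + (t\<^sup>2) ^ n < t / 4"
    by (rule order_tendstoD(2)) (use assms in simp)
  then show ?thesis
    by eventually_elim (simp add: power_mult)
qed

text \<open>One quantity \<open>T\<close> serves all three claims, and it tends to infinity along
  \<open>n j\<close>. As (k/m)^2 \<le> 1, it is at most the truncated norm quotient of \<phi>^m,
  which is a row sum for the inverse weights. By the symmetry of the matrix it is also
  \<open>(b m)\<^sup>2\<close> times a column sum, which boundedness for \<open>b\<close> would
  control.\<close>

lemma composition_unbounded:
  fixes w :: "nat \<Rightarrow> real" and \<alpha> :: "nat \<Rightarrow> real" and n :: "nat \<Rightarrow> nat"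
  assumes w: "\<And>k. k \<ge> 1 \<Longrightarrow> w k > 0" "w \<longlonglongrightarrow> 1"
    and \<alpha>: "filterlim \<alpha> at_top sequentially" and n: "filterlim n at_top sequentially"
    and dom: "\<And>j k. j \<ge> 1 \<Longrightarrow> k \<le> n j \<Longrightarrow>
      weight_prod w (n j) / weight_prod w k \<ge> beta_alpha (\<alpha> j) k / beta_alpha (\<alpha> j) (n j)"
    and t: "0 < t" "t < 1"
  shows "filterlim (\<lambda>j. (hardy_norm (\<lambda>k. 1 / weight_prod w k) (\<lambda>z. disk_aut t z ^ n j))\<^sup>2
           / (hardy_norm (\<lambda>k. 1 / weight_prod w k) (\<lambda>z. z ^ n j))\<^sup>2) at_top sequentially"
    and "\<not> bounded_composition_op (\<lambda>k. 1 / weight_prod w k) (disk_aut t)"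
    and "\<not> bounded_composition_op (weight_prod w) (disk_aut t)"
proof -
  define b where "b = weight_prod w"
  define a where "a m k = (cmod (taylor_coeff (\<lambda>z. disk_aut t z ^ m) k))\<^sup>2" for m k
  define T where "T m = (\<Sum>k\<le>m. (real k / real m)\<^sup>2 * a m k * (b m / b k)\<^sup>2)" for m
  define L where "L m = (\<Sum>k\<le>m. a m k * (1 / b k)\<^sup>2)" for m
  have b: "b k > 0" for k
    unfolding b_def by (rule weight_prod_pos) (rule w)
  have "\<forall>\<^sub>F j in sequentially. \<alpha> j \<ge> 1" "\<forall>\<^sub>F j in sequentially. n j \<ge> 1"
    using \<alpha> n by (simp_all add: filterlim_at_top)
  moreover have "\<forall>\<^sub>F j in sequentially. 1 / (4 * real (n j)) + t ^ (2 * n j) \<le> t / 4"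
    by (rule eventually_compose_filterlim[OF low_mass_threshold[OF t] n])
  moreover have "\<forall>\<^sub>F j in sequentially. j \<ge> (1::nat)"
    by (rule eventually_ge_at_top)
  ultimately have ev: "\<forall>\<^sub>F j in sequentially. (\<alpha> j - 1) * (t / 96) \<le> T (n j)"
  proof eventually_elim
    case (elim j)
    then show ?case
      using weighted_low_mass[OF t, of "n j" "\<alpha> j" b] dom[of j] by (simp add: T_def a_def b_def)
  qed
  have "filterlim (\<lambda>j. (-1 + \<alpha> j) * (t / 96)) at_top sequentially"
    by (rule filterlim_at_top_mult_tendsto_pos[OF tendsto_const _
          filterlim_tendsto_add_at_top[OF tendsto_const \<alpha>]]) (use t in simp)
  then have T: "filterlim (\<lambda>j. T (n j)) at_top sequentially"
    by (rule filterlim_at_top_mono) (use ev in simp)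
  have T_unbounded: "\<not> (\<forall>m. T m \<le> C)" for C
  proof
    assume "\<forall>m. T m \<le> C"
    moreover have "\<forall>\<^sub>F j in sequentially. T (n j) > C"
      using T by (simp add: filterlim_at_top_dense)
    then obtain j where "T (n j) > C"
      by (auto simp: eventually_sequentially)
    ultimately show False
      by (meson not_le)
  qed
  have TL: "T m \<le> L m * (b m)\<^sup>2" for m
    unfolding T_def L_def sum_distrib_right
  proof (rule sum_mono)
    fix k assume "k \<in> {..m}"
    then have "real k / real m \<le> 1"
      by (cases "m = 0") (auto simp: divide_le_eq_1)
    then have "(real k / real m)\<^sup>2 \<le> 1"
      by (simp add: power_le_one)
    then have "(real k / real m)\<^sup>2 * (a m k * (b m / b k)\<^sup>2) \<le> 1 * (a m k * (b m / b k)\<^sup>2)"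
      by (rule mult_right_mono) (simp add: a_def)
    then show "(real k / real m)\<^sup>2 * a m k * (b m / b k)\<^sup>2 \<le> a m k * (1 / b k)\<^sup>2 * (b m)\<^sup>2"
      by (simp add: power_divide mult_ac)
  qed
  show "filterlim (\<lambda>j. (hardy_norm (\<lambda>k. 1 / weight_prod w k) (\<lambda>z. disk_aut t z ^ n j))\<^sup>2
           / (hardy_norm (\<lambda>k. 1 / weight_prod w k) (\<lambda>z. z ^ n j))\<^sup>2) at_top sequentially"
  proof (rule filterlim_at_top_mono[OF T], rule always_eventually, rule allI)
    fix j
    have "T (n j) \<le> L (n j) * (b (n j))\<^sup>2"
      by (rule TL)
    also have "L (n j) \<le> (hardy_norm (\<lambda>k. 1 / b k) (\<lambda>z. disk_aut t z ^ n j))\<^sup>2"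
      unfolding L_def a_def b_def
      by (intro sum_le_hardy_norm_squared disk_aut_power_in_weighted_hardy t w) auto
    finally show "T (n j) \<le> (hardy_norm (\<lambda>k. 1 / weight_prod w k) (\<lambda>z. disk_aut t z ^ n j))\<^sup>2
           / (hardy_norm (\<lambda>k. 1 / weight_prod w k) (\<lambda>z. z ^ n j))\<^sup>2"
      unfolding hardy_norm_monomial by (simp add: b_def power_divide mult_right_mono)
  qed
  show "\<not> bounded_composition_op (\<lambda>k. 1 / weight_prod w k) (disk_aut t)"
  proof
    assume "bounded_composition_op (\<lambda>k. 1 / weight_prod w k) (disk_aut t)"
    then obtain C where C: "\<And>m. L m \<le> C * (1 / b m)\<^sup>2"
      using bounded_composition_op_rows unfolding L_def a_def b_def by blast
    have "L m * (b m)\<^sup>2 \<le> C" for m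
      using C[of m] b[of m] by (simp add: power_divide pos_le_divide_eq)
    then have "T m \<le> C" for m
      using TL[of m] by (rule order_trans[rotated])
    then show False
      using T_unbounded by blast
  qed
  show "\<not> bounded_composition_op (weight_prod w) (disk_aut t)"
  proof
    assume "bounded_composition_op (weight_prod w) (disk_aut t)"
    then have bounded: "bounded_composition_op b (disk_aut t)"
      by (simp add: b_def)
    have "disk_aut t holomorphic_on ball 0 (1 / t)"
      using disk_aut_power_holomorphic[OF t(1), of 1] by simp
    then have "disk_aut t holomorphic_on ball 0 1"
      by (rule holomorphic_on_subset) (use t in \<open>auto intro!: ball_subset_ball_iff [THEN iffD2]\<close>)
    then obtain C where C: "\<And>m. (\<Sum>k\<le>m. a k m / (b k)\<^sup>2) \<le> C / (b m)\<^sup>2"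
      using bounded_composition_op_columns[OF bounded _ b] unfolding a_def by metis
    have "T m \<le> C" if "m > 0" for m
    proof -
      \<comment> \<open>The symmetry, divided by \<open>m\<close> and squared, turns the entries of
        row \<open>m\<close> into those of column \<open>m\<close>.\<close>
      have sym: "(real k / real m)\<^sup>2 * a m k = a k m" for k
      proof -
        have "cmod (of_nat k * taylor_coeff (\<lambda>z. disk_aut t z ^ m) k) =
            cmod (of_nat m * taylor_coeff (\<lambda>z. disk_aut t z ^ k) m)"
          by (simp only: taylor_coeff_disk_aut_symmetry)
        then have "real k / real m * cmod (taylor_coeff (\<lambda>z. disk_aut t z ^ m) k) =
            cmod (taylor_coeff (\<lambda>z. disk_aut t z ^ k) m)"
          using that by (simp add: norm_mult field_simps)
        then show ?thesis
          unfolding a_def by (simp flip: power_mult_distrib)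
      qed
      have "T m = (\<Sum>k\<le>m. a k m / (b k)\<^sup>2) * (b m)\<^sup>2"
        unfolding T_def sym by (simp add: sum_distrib_right power_divide)
      also have "\<dots> \<le> C"
        using C[of m] b[of m] by (simp add: pos_le_divide_eq)
      finally show ?thesis .
    qed
    \<comment> \<open>The division by \<open>m\<close> excluded \<open>m = 0\<close>; there the only
      term has the factor 0 / 0 = 0.\<close>
    moreover have "T 0 = 0"
      by (simp add: T_def)
    ultimately have "T m \<le> max C 0" for m
      by (cases "m = 0") (auto simp: le_max_iff_disj)
    then show False
      using T_unbounded by blast
  qed
qed

section \<open>Weights with (k + 1) (w_k - 1) tending to plus or minus infinity\<close>

text \<open>Take the first index from \<open>N\<close> on at which \<open>X\<close> exceeds its
  maximum over \<open>{..N}\<close>; earlier values stay below that maximum, either by its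
  definition or by minimality.\<close>

lemma obtain_running_maximum:
  fixes X :: "nat \<Rightarrow> real"
  assumes "filterlim X at_top sequentially"
  obtains n where "n \<ge> N" "\<And>k. k \<le> n \<Longrightarrow> X k \<le> X n"
proof -
  define M where "M = Max (X ` {..N})"
  have M: "X k \<le> M" if "k \<le> N" for k
    unfolding M_def by (rule Max_ge) (use that in auto)
  have "\<forall>\<^sub>F n in sequentially. n \<ge> N \<and> X n > M"
    using assms by (intro eventually_conj eventually_ge_at_top) (simp add: filterlim_at_top_dense)
  then have ex: "\<exists>n. n \<ge> N \<and> X n > M"
    by (rule eventually_happens'[rotated]) simp
  define n where "n = (LEAST n. n \<ge> N \<and> X n > M)"
  have n: "n \<ge> N" "X n > M"
    using LeastI_ex[OF ex] by (simp_all add: n_def)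
  have "X k \<le> X n" if "k \<le> n" for k
  proof (cases "k = n \<or> k \<le> N")
    case True
    then show ?thesis
      using M n by force
  next
    case False
    then have "\<not> X k > M"
      using not_less_Least[of k "\<lambda>n. n \<ge> N \<and> X n > M"] that by (auto simp: n_def)
    then show ?thesis
      using n by simp
  qed
  with n(1) show ?thesis
    using that by blast
qed

text \<open>The domination hypothesis says that this product is at least as large at n as at every k
  \<le> n, so its running maxima provide the n_j. Eventually the quotient of consecutive values is
  at least 1 + 1/m with m = k + 2, so the product grows at least linearly.\<close>

lemma weight_beta_alpha_at_top:
  assumes w: "\<And>k. k \<ge> 1 \<Longrightarrow> w k > 0"
    and lim: "filterlim (\<lambda>k. (real k + 1) * (w k - 1)) at_top sequentially" and \<alpha>: "\<alpha> \<ge> 0"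
  shows "filterlim (\<lambda>k. weight_prod w k * beta_alpha \<alpha> k) at_top sequentially"
proof -
  define R where "R k = weight_prod w k * beta_alpha \<alpha> k" for k
  have R_pos: "R k > 0" for k
    unfolding R_def using weight_prod_pos[of w k, OF w] beta_alpha_pos[OF \<alpha>, of k] by simp
  \<comment> \<open>In \<open>2 * \<alpha> + 1\<close>, one \<alpha> offsets the decay of
    \<open>beta_alpha\<close>, the 1 gives linear growth, and the other \<alpha> absorbs the
    constant term of (m + 1) (m + \<alpha>).\<close>
  obtain N where N: "\<And>k. k \<ge> N \<Longrightarrow> 2 * \<alpha> + 1 \<le> (real k + 1) * (w k - 1)"
    using lim by (auto simp: filterlim_at_top eventually_sequentially)
  have step: "R k / (real k + 2) \<le> R (Suc k) / (real (Suc k) + 2)" if "k \<ge> N" for k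
  proof -
    define m where "m = real k + 2"
    have m: "m \<ge> 2"
      by (simp add: m_def)
    have "m * (m + 2 * \<alpha> + 1) \<le> m * (m * w (Suc k))"
      using N[of "Suc k"] that m by (intro mult_left_mono) (auto simp: m_def algebra_simps)
    moreover have "\<alpha> \<le> \<alpha> * m"
      using mult_left_mono[of 1 m \<alpha>] m \<alpha> by simp
    ultimately have w_ge: "(m + 1) * (m + \<alpha>) \<le> m * m * w (Suc k)"
      by (simp add: algebra_simps)
    \<comment> \<open>This is sqrt (1 + 2 x) \<le> 1 + x for x = \<alpha> / m.\<close>
    have "sqrt ((m + 2 * \<alpha>) / m) \<le> (m + \<alpha>) / m"
    proof (rule real_le_lsqrt)
      show "0 \<le> (m + \<alpha>) / m"
        using m \<alpha> by simp
      show "(m + 2 * \<alpha>) / m \<le> ((m + \<alpha>) / m)\<^sup>2"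
        using m by (simp add: divide_simps power2_eq_square) (simp add: algebra_simps)
    qed
    then have "(m + 1) * sqrt ((m + 2 * \<alpha>) / m) \<le> (m + 1) * ((m + \<alpha>) / m)"
      using m by (intro mult_left_mono) auto
    also have "\<dots> \<le> m * w (Suc k)"
      using w_ge m by (simp add: divide_simps mult_ac)
    finally have key: "(m + 1) * sqrt ((m + 2 * \<alpha>) / m) \<le> m * w (Suc k)" .
    have sq: "sqrt ((m + 2 * \<alpha>) / m) * sqrt (m / (m + 2 * \<alpha>)) = 1"
      using m \<alpha> by (simp flip: real_sqrt_mult)
    have "(m + 1) * sqrt ((m + 2 * \<alpha>) / m) * sqrt (m / (m + 2 * \<alpha>)) \<le> m * w (Suc k) * sqrt (m / (m + 2 * \<alpha>))"
      by (rule mult_right_mono[OF key]) (use m \<alpha> in simp)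
    then have "m + 1 \<le> m * (w (Suc k) * sqrt (m / (m + 2 * \<alpha>)))"
      by (simp only: mult.assoc sq mult_1_right)
    then have "R k * (m + 1) \<le> R k * (m * (w (Suc k) * sqrt (m / (m + 2 * \<alpha>))))"
      using R_pos[of k] by (intro mult_left_mono) auto
    also have "\<dots> = m * R (Suc k)"
      by (simp add: R_def weight_prod_Suc beta_alpha_Suc m_def algebra_simps)
    finally show ?thesis
      using m by (simp add: m_def field_simps)
  qed
  have "R N / (real N + 2) \<le> R k / (real k + 2)" if "k \<ge> N" for k
    using that by (induction k rule: dec_induct) (use step in force)+
  then have "\<forall>\<^sub>F k in sequentially. (real k + 2) * (R N / (real N + 2)) \<le> R k"
    by (intro eventually_sequentiallyI[of N]) (simp add: pos_le_divide_eq mult.commute)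
  moreover have "filterlim (\<lambda>k. (real k + 2) * (R N / (real N + 2))) at_top sequentially"
  proof (rule filterlim_at_top_mult_tendsto_pos[OF tendsto_const])
    show "0 < R N / (real N + 2)"
      using R_pos by simp
    show "filterlim (\<lambda>k. real k + 2) at_top sequentially"
      using filterlim_tendsto_add_at_top[OF tendsto_const filterlim_real_sequentially, of 2]
      by (simp add: add.commute)
  qed
  ultimately show ?thesis
    unfolding R_def [symmetric] by (rule filterlim_at_top_mono[rotated])
qed

lemma composition_unbounded_of_weights_at_top:
  assumes w: "\<And>k. k \<ge> 1 \<Longrightarrow> w k > 0" "w \<longlonglongrightarrow> 1"
    and lim: "filterlim (\<lambda>k. (real k + 1) * (w k - 1)) at_top sequentially" and t: "0 < t" "t < 1"
  shows "\<not> bounded_composition_op (\<lambda>k. 1 / weight_prod w k) (disk_aut t)"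
    and "\<not> bounded_composition_op (weight_prod w) (disk_aut t)"
proof -
  \<comment> \<open>With \<alpha>_j = j, a running maximum at or beyond \<open>j\<close> serves as
    n_j, so both sequences tend to infinity.\<close>
  have "\<exists>n\<ge>j. \<forall>k\<le>n. weight_prod w k * beta_alpha (real j) k \<le> weight_prod w n * beta_alpha (real j) n" for j
    using obtain_running_maximum[OF weight_beta_alpha_at_top[OF w(1) lim], of "real j" j]
    by (metis of_nat_0_le_iff)
  then obtain n where n: "\<And>j. n j \<ge> j"
    "\<And>j k. k \<le> n j \<Longrightarrow> weight_prod w k * beta_alpha (real j) k \<le> weight_prod w (n j) * beta_alpha (real j) (n j)"
    by metis
  have "filterlim n at_top sequentially"
    using filterlim_ident by (rule filterlim_at_top_mono) (simp add: n)
  moreover have "weight_prod w (n j) / weight_prod w k \<ge> beta_alpha (real j) k / beta_alpha (real j) (n j)"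
    if "k \<le> n j" for j k
    using n(2)[OF that] weight_prod_pos[of w k, OF w(1)] beta_alpha_pos[of "real j" "n j"]
    by (simp add: divide_simps mult_ac)
  ultimately show "\<not> bounded_composition_op (\<lambda>k. 1 / weight_prod w k) (disk_aut t)"
    and "\<not> bounded_composition_op (weight_prod w) (disk_aut t)"
    using composition_unbounded(2,3)[OF w filterlim_real_sequentially, of n] t by blast+
qed

lemma weight_prod_inverse: "weight_prod (\<lambda>k. 1 / w k) = (\<lambda>k. 1 / weight_prod w k)"
  by (rule ext) (simp add: weight_prod_def prod_dividef)

text \<open>1/w - 1 = -(w - 1) / w, and 1/w tends to 1.\<close>

lemma inverse_weights_at_top:
  assumes w: "\<And>k. k \<ge> 1 \<Longrightarrow> w k > 0" "w \<longlonglongrightarrow> 1"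
    and lim: "filterlim (\<lambda>k. (real k + 1) * (w k - 1)) at_bot sequentially"
  shows "filterlim (\<lambda>k. (real k + 1) * (1 / w k - 1)) at_top sequentially"
proof -
  have "filterlim (\<lambda>k. - ((real k + 1) * (w k - 1))) at_top sequentially"
    using lim by (simp add: filterlim_uminus_at_top)
  moreover have "(\<lambda>k. 1 / w k) \<longlonglongrightarrow> 1 / 1"
    by (intro tendsto_intros w) simp
  ultimately have "filterlim (\<lambda>k. - ((real k + 1) * (w k - 1)) * (1 / w k)) at_top sequentially"
    using filterlim_at_top_mult_tendsto_pos by fastforce
  then show ?thesis
  proof (rule filterlim_mono_eventually)
    \<comment> \<open>The identity needs \<open>w k\<close> nonzero, which is known from
      \<open>k = 1\<close> on.\<close>
    show "\<forall>\<^sub>F k in sequentially. - ((real k + 1) * (w k - 1)) * (1 / w k) = (real k + 1) * (1 / w k - 1)"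
      using eventually_ge_at_top[of 1]
    proof eventually_elim
      case (elim k)
      then show ?case
        using w(1)[of k] by (simp add: field_simps)
    qed
  qed simp_all
qed

theorem theorem2p4:
  fixes w \<beta> \<beta>inv :: "nat \<Rightarrow> real"
  defines "\<beta> \<equiv> weight_prod w"
    and "\<beta>inv \<equiv> (\<lambda>k. 1 / weight_prod w k)"
  assumes w_pos: "\<And>k. k \<ge> 1 \<Longrightarrow> w k > 0"
    and w_lim: "w \<longlonglongrightarrow> 1"
  shows "(\<forall>(\<alpha> :: nat \<Rightarrow> real) (n :: nat \<Rightarrow> nat).
            (\<forall>j\<ge>1. \<alpha> j > 0) \<and> filterlim \<alpha> at_top sequentially \<and>
            (\<forall>j\<ge>1. n j > 0) \<and> filterlim n at_top sequentially \<and>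
            (\<forall>j\<ge>1. \<forall>k\<le>n j. \<beta> (n j) / \<beta> k \<ge> beta_alpha (\<alpha> j) k / beta_alpha (\<alpha> j) (n j))
            \<longrightarrow> (\<forall>t\<in>{0<..<1}.
                  filterlim (\<lambda>j. (hardy_norm \<beta>inv (\<lambda>z. disk_aut t z ^ n j))\<^sup>2
                                 / (hardy_norm \<beta>inv (\<lambda>z. z ^ n j))\<^sup>2) at_top sequentially \<and>
                  \<not> bounded_composition_op \<beta>inv (disk_aut t) \<and>
                  \<not> bounded_composition_op \<beta> (disk_aut t)))
       \<and> (filterlim (\<lambda>k. (real k + 1) * (w k - 1)) at_top sequentially \<or>
          filterlim (\<lambda>k. (real k + 1) * (w k - 1)) at_bot sequentially
            \<longrightarrow> (\<forall>t\<in>{0<..<1}.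
                  \<not> bounded_composition_op \<beta>inv (disk_aut t) \<and>
                  \<not> bounded_composition_op \<beta> (disk_aut t)))"
proof (intro conjI allI impI ballI)
  fix \<alpha> :: "nat \<Rightarrow> real" and n :: "nat \<Rightarrow> nat" and t :: real
  assume "(\<forall>j\<ge>1. \<alpha> j > 0) \<and> filterlim \<alpha> at_top sequentially \<and>
      (\<forall>j\<ge>1. n j > 0) \<and> filterlim n at_top sequentially \<and>
      (\<forall>j\<ge>1. \<forall>k\<le>n j. \<beta> (n j) / \<beta> k \<ge> beta_alpha (\<alpha> j) k / beta_alpha (\<alpha> j) (n j))"
    and "t \<in> {0<..<1}"
  then have "filterlim \<alpha> at_top sequentially" "filterlim n at_top sequentially"
    "\<And>j k. j \<ge> 1 \<Longrightarrow> k \<le> n j \<Longrightarrow>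
      weight_prod w (n j) / weight_prod w k \<ge> beta_alpha (\<alpha> j) k / beta_alpha (\<alpha> j) (n j)"
    "0 < t" "t < 1"
    by (auto simp: \<beta>_def)
  note main = composition_unbounded[OF w_pos w_lim this]
  show "filterlim (\<lambda>j. (hardy_norm \<beta>inv (\<lambda>z. disk_aut t z ^ n j))\<^sup>2
          / (hardy_norm \<beta>inv (\<lambda>z. z ^ n j))\<^sup>2) at_top sequentially"
    unfolding \<beta>inv_def by (rule main(1))
  show "\<not> bounded_composition_op \<beta>inv (disk_aut t)"
    unfolding \<beta>inv_def by (rule main(2))
  show "\<not> bounded_composition_op \<beta> (disk_aut t)"
    unfolding \<beta>_def by (rule main(3))
next
  fix t :: real
  assume lim: "filterlim (\<lambda>k. (real k + 1) * (w k - 1)) at_top sequentially \<or>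
      filterlim (\<lambda>k. (real k + 1) * (w k - 1)) at_bot sequentially"
    and "t \<in> {0<..<1}"
  then have t: "0 < t" "t < 1"
    by auto
  have "\<not> bounded_composition_op \<beta>inv (disk_aut t) \<and> \<not> bounded_composition_op \<beta> (disk_aut t)"
    using lim
  proof
    assume "filterlim (\<lambda>k. (real k + 1) * (w k - 1)) at_top sequentially"
    then show ?thesis
      unfolding \<beta>_def \<beta>inv_def
      using composition_unbounded_of_weights_at_top[OF w_pos w_lim _ t] by blast
  next
    assume "filterlim (\<lambda>k. (real k + 1) * (w k - 1)) at_bot sequentially"
    \<comment> \<open>Passing from \<open>w\<close> to \<open>1 / w\<close> exchanges the two
      spaces, so this case is the previous one with its conclusions swapped.\<close>
    note inv_lim = inverse_weights_at_top[OF w_pos w_lim this]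
    have inv_pos: "1 / w k > 0" if "k \<ge> 1" for k
      using w_pos[OF that] by simp
    have "(\<lambda>k. 1 / w k) \<longlonglongrightarrow> 1 / 1"
      by (intro tendsto_intros w_lim) simp
    then have "(\<lambda>k. 1 / w k) \<longlonglongrightarrow> 1"
      by simp
    from composition_unbounded_of_weights_at_top[OF inv_pos this inv_lim t] show ?thesis
      by (simp add: weight_prod_inverse \<beta>_def \<beta>inv_def)
  qed
  then show "\<not> bounded_composition_op \<beta>inv (disk_aut t)" "\<not> bounded_composition_op \<beta> (disk_aut t)"
    by auto
qed

end
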